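(* There exists a polynomial-time constant-approximation algorithm for computing the coarseness: there are a constant $c\in(0,1]$ and an algorithm that, given a finite nonempty set $S=R\cup B$ of $n$ points in general position in the plane, colored red (the points of $R$) and blue (the points of $B$), runs in time polynomial in $n$ and outputs a number $v$ with $c\,\mathcal{C}(S)\le v\le \mathcal{C}(S)$.
   Context: General position means that no three points of $S$ are collinear. For $Y\subseteq S$, the discrepancy of $Y$ is $\operatorname{disc}(Y)=\bigl||Y\cap R|-|Y\cap B|\bigr|$. An island of $S$ is a subset $I\subseteq S$ such that $I=C\cap S$ for some convex set $C\subseteq\mathbb{R}^2$. A convex partition of $S$ is a partition $\Pi=\{S_1,\dots,S_m\}$ of $S$ into (nonempty) islands with pairwise disjoint convex hulls; its discrepancy is $\operatorname{disc}(\Pi)=\min_{1\le i\le m}\operatorname{disc}(S_i)$. The coarseness of the colored set $S$ is $\mathcal{C}(S)=\max_{\Pi}\operatorname{disc}(\Pi)$, the maximum over all convex partitions $\Pi$ of $S$. Running time is measured in the usual computational-geometry model (arithmetic operations and comparisons on point coordinates at unit cost). *)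

theory Defs
  imports "HOL-Analysis.Analysis" "HOL-Computational_Algebra.Polynomial"
begin

section \<open>Coarseness of a bicolored point set\<close>

definition general_position :: "(real^2) set \<Rightarrow> bool" where
  "general_position S \<longleftrightarrow>
     (\<forall>a\<in>S. \<forall>b\<in>S. \<forall>c\<in>S. a \<noteq> b \<and> b \<noteq> c \<and> a \<noteq> c \<longrightarrow> \<not> collinear {a, b, c})"

definition disc :: "'a set \<Rightarrow> 'a set \<Rightarrow> 'a set \<Rightarrow> int" where
  "disc R B Y = \<bar>int (card (Y \<inter> R)) - int (card (Y \<inter> B))\<bar>"

definition island :: "(real^2) set \<Rightarrow> (real^2) set \<Rightarrow> bool" where
  "island S I \<longleftrightarrow> I \<subseteq> S \<and> (\<exists>C. convex C \<and> I = C \<inter> S)"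

definition convex_partition :: "(real^2) set \<Rightarrow> (real^2) set set \<Rightarrow> bool" where
  "convex_partition S P \<longleftrightarrow>
     partition_on S P \<and> (\<forall>I\<in>P. island S I) \<and>
     pairwise (\<lambda>I J. convex hull I \<inter> convex hull J = {}) P"

definition partition_disc :: "'a set \<Rightarrow> 'a set \<Rightarrow> 'a set set \<Rightarrow> int" where
  "partition_disc R B P = Min (disc R B ` P)"

definition coarseness :: "(real^2) set \<Rightarrow> (real^2) set \<Rightarrow> int" where
  "coarseness R B = Max (partition_disc R B ` {P. convex_partition (R \<union> B) P})"

text \<open>For a finite nonempty point set, the minimum and the maximum above range over finite
  nonempty sets.\<close>

lemma finite_convex_partitions: "finite S \<Longrightarrow> finite {P. convex_partition S P}"
  by (rule finite_subset[of _ "Pow (Pow S)"]) (auto simp: convex_partition_def partition_on_def)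

lemma convex_partition_trivial: "S \<noteq> {} \<Longrightarrow> convex_partition S {S}"
  by (auto simp: convex_partition_def partition_on_def island_def intro!: exI[of _ UNIV])

lemma convex_partition_finite_nonempty:
  assumes "convex_partition S P" "finite S" "S \<noteq> {}"
  shows "finite P" "P \<noteq> {}"
  using assms by (auto simp: convex_partition_def partition_on_def intro: finite_UnionD)


section \<open>Real RAM programs\<close>

text \<open>
  Programs are finite syntax trees over a memory of named, zero-initialized, unbounded arrays of two
  kinds: arrays of natural numbers, used for counting and for (indirect) addressing, and arrays of
  reals. A scalar variable is cell 0 of an array. Every operation (constant, array access, arithmetic
  operation, comparison, Boolean connective, assignment, branch) costs one unit.

  Three restrictions keep unit cost honest. Program texts contain no real constants, only naturals,
  so no information can be hidden in a constant. There is no operation, such as rounding, that turns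
  a real into a natural other than branching on a comparison. Naturals can be added and subtracted
  (truncated at 0) but not multiplied, so their bit length grows at most linearly in the running time.
  Division of reals by zero yields 0, as usual in HOL.
\<close>

type_synonym name = string

record state =
  nats :: "name \<Rightarrow> nat \<Rightarrow> nat"
  reals :: "name \<Rightarrow> nat \<Rightarrow> real"

datatype nexp =
    NConst nat
  | NGet name nexp
  | NAdd nexp nexp
  | NSub nexp nexp

datatype rexp =
    RNat nexp
  | RGet name nexp
  | RAdd rexp rexp
  | RSub rexp rexp
  | RMul rexp rexp
  | RDiv rexp rexp

datatype bexp =
    NLess nexp nexp
  | RLess rexp rexp
  | BNot bexp
  | BAnd bexp bexp

datatype com =
    Skip
  | NSet name nexp nexp
  | RSet name nexp rexp
  | Seq com com
  | Cond bexp com com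
  | While bexp com

primrec nval :: "nexp \<Rightarrow> state \<Rightarrow> nat" where
  "nval (NConst k) s = k"
| "nval (NGet a e) s = nats s a (nval e s)"
| "nval (NAdd e f) s = nval e s + nval f s"
| "nval (NSub e f) s = nval e s - nval f s"

primrec rval :: "rexp \<Rightarrow> state \<Rightarrow> real" where
  "rval (RNat e) s = real (nval e s)"
| "rval (RGet a e) s = reals s a (nval e s)"
| "rval (RAdd e f) s = rval e s + rval f s"
| "rval (RSub e f) s = rval e s - rval f s"
| "rval (RMul e f) s = rval e s * rval f s"
| "rval (RDiv e f) s = rval e s / rval f s"

primrec bval :: "bexp \<Rightarrow> state \<Rightarrow> bool" where
  "bval (NLess e f) s \<longleftrightarrow> nval e s < nval f s"
| "bval (RLess e f) s \<longleftrightarrow> rval e s < rval f s"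
| "bval (BNot b) s \<longleftrightarrow> \<not> bval b s"
| "bval (BAnd b d) s \<longleftrightarrow> bval b s \<and> bval d s"

primrec ncost :: "nexp \<Rightarrow> nat" where
  "ncost (NConst k) = 1"
| "ncost (NGet a e) = 1 + ncost e"
| "ncost (NAdd e f) = 1 + ncost e + ncost f"
| "ncost (NSub e f) = 1 + ncost e + ncost f"

primrec rcost :: "rexp \<Rightarrow> nat" where
  "rcost (RNat e) = 1 + ncost e"
| "rcost (RGet a e) = 1 + ncost e"
| "rcost (RAdd e f) = 1 + rcost e + rcost f"
| "rcost (RSub e f) = 1 + rcost e + rcost f"
| "rcost (RMul e f) = 1 + rcost e + rcost f"
| "rcost (RDiv e f) = 1 + rcost e + rcost f"

primrec bcost :: "bexp \<Rightarrow> nat" where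
  "bcost (NLess e f) = 1 + ncost e + ncost f"
| "bcost (RLess e f) = 1 + rcost e + rcost f"
| "bcost (BNot b) = 1 + bcost b"
| "bcost (BAnd b d) = 1 + bcost b + bcost d"

definition nset :: "name \<Rightarrow> nat \<Rightarrow> nat \<Rightarrow> state \<Rightarrow> state" where
  "nset a i v s = s\<lparr>nats := (nats s)(a := (nats s a)(i := v))\<rparr>"

definition rset :: "name \<Rightarrow> nat \<Rightarrow> real \<Rightarrow> state \<Rightarrow> state" where
  "rset a i v s = s\<lparr>reals := (reals s)(a := (reals s a)(i := v))\<rparr>"

text \<open>\<open>exec c s t s'\<close>: started in state \<open>s\<close>, program \<open>c\<close> halts after exactly \<open>t\<close> steps in state
  \<open>s'\<close>. A program that does not halt is related to no \<open>t\<close> and \<open>s'\<close>.\<close>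

inductive exec :: "com \<Rightarrow> state \<Rightarrow> nat \<Rightarrow> state \<Rightarrow> bool" where
  Skip: "exec Skip s 1 s"
| NSet: "exec (NSet a e f) s (1 + ncost e + ncost f) (nset a (nval e s) (nval f s) s)"
| RSet: "exec (RSet a e f) s (1 + ncost e + rcost f) (rset a (nval e s) (rval f s) s)"
| Seq: "exec c s t s' \<Longrightarrow> exec d s' u s'' \<Longrightarrow> exec (Seq c d) s (t + u) s''"
| CondTrue: "bval b s \<Longrightarrow> exec c s t s' \<Longrightarrow> exec (Cond b c d) s (1 + bcost b + t) s'"
| CondFalse: "\<not> bval b s \<Longrightarrow> exec d s t s' \<Longrightarrow> exec (Cond b c d) s (1 + bcost b + t) s'"
| WhileFalse: "\<not> bval b s \<Longrightarrow> exec (While b c) s (1 + bcost b) s"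
| WhileTrue: "bval b s \<Longrightarrow> exec c s t s' \<Longrightarrow> exec (While b c) s' u s'' \<Longrightarrow>
    exec (While b c) s (1 + bcost b + t + u) s''"

inductive_cases SkipE: "exec Skip s t s'"
inductive_cases NSetE: "exec (NSet a e f) s t s'"
inductive_cases RSetE: "exec (RSet a e f) s t s'"
inductive_cases SeqE: "exec (Seq c d) s t s'"
inductive_cases CondE: "exec (Cond b c d) s t s'"
inductive_cases WhileE: "exec (While b c) s t s'"

lemma exec_deterministic: "exec c s t s' \<Longrightarrow> exec c s u s'' \<Longrightarrow> u = t \<and> s'' = s'"
proof (induction arbitrary: u s'' rule: exec.induct)
  case (Skip s)
  from Skip.prems show ?case by (rule SkipE) simp
next
  case (NSet a e f s)
  from NSet.prems show ?case by (rule NSetE) simp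
next
  case (RSet a e f s)
  from RSet.prems show ?case by (rule RSetE) simp
next
  case (Seq c s t s' d t2 s2)
  from Seq.prems show ?case by (rule SeqE) (auto dest!: Seq.IH)
next
  case (CondTrue b s c t s' d)
  from CondTrue.prems show ?case by (rule CondE) (use CondTrue.hyps(1) in \<open>auto dest!: CondTrue.IH\<close>)
next
  case (CondFalse b s d t s' c)
  from CondFalse.prems show ?case by (rule CondE) (use CondFalse.hyps(1) in \<open>auto dest!: CondFalse.IH\<close>)
next
  case (WhileFalse b s c)
  from WhileFalse.prems show ?case by (rule WhileE) (use WhileFalse.hyps in simp_all)
next
  case (WhileTrue b s c t s' t2 s2)
  from WhileTrue.prems show ?case by (rule WhileE) (use WhileTrue.hyps(1) in \<open>auto dest!: WhileTrue.IH\<close>)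
qed


subsection \<open>Input and output\<close>

text \<open>The points are presented in the order of a list \<open>ps\<close>; color 1 is red, color 0 is blue.\<close>

definition input :: "(real^2) list \<Rightarrow> (real^2) set \<Rightarrow> state" where
  "input ps R = \<lparr>
     nats = (\<lambda>_ _. 0)
       (''n'' := (\<lambda>_. 0)(0 := length ps),
        ''color'' := (\<lambda>i. if i < length ps \<and> ps ! i \<in> R then 1 else 0)),
     reals = (\<lambda>_ _. 0)
       (''x'' := (\<lambda>i. if i < length ps then (ps ! i) $ 1 else 0),
        ''y'' := (\<lambda>i. if i < length ps then (ps ! i) $ 2 else 0))\<rparr>"

definition output_value :: "state \<Rightarrow> real" where
  "output_value s = reals s ''out'' 0"

end

(*
  A partition of maximal discrepancy contains an island cut out of S by at most 8 halfplanes: the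
  vertical visibility graph of its m convex hulls has at most 3m edges, so some hull sees at most 6
  others, and lines separating it from those together with two vertical lines separate it from all
  the others. Since one of the 8 cells determined by three halfplanes is empty, the balance
  (red minus blue) of such an island is at most a constant times the maximal balance of a wedge,
  the intersection of two halfplanes. Conversely, a wedge of balance d yields a convex partition
  of discrepancy of order d, obtained by splitting its complement. So the coarseness is within
  constant factors of the maximal balance of a wedge. Up to two points, every wedge cut is bounded
  by lines through pairs of points of S, and as the coarseness is at least 1, the algorithm may
  ignore the difference and try all quadruples of points.
*)
theory Submission
  imports Defs
begin

text \<open>An optimal partition may consist of many islands with many sides, but each of its
  islands has discrepancy at least the coarseness, so bounding a single simple one is enough. The
  passage from 8 halfplanes to 2 rests on additivity of the signed balance: replacing a halfplane by
  its complement changes the absolute balance by at most the balance of an intersection with one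
  halfplane fewer. At most three such flips reach an empty cell, so each dropped halfplane costs a
  factor 3; this is the source of \<open>3 ^ 8\<close>. The descent stops at 2 because two crossing
  lines leave no cell of the plane empty, which is why wedges and not halfplanes are searched. The
  obstacle in the converse is that one island of large balance says nothing about a partition until
  the rest is cut into convex pieces of large balance too. A rotating line achieves this because
  general position lets the balance jump by at most 2.\<close>

section \<open>Vertical visibility between disjoint convex sets\<close>

text \<open>One pair of witnesses is enough: for disjoint convex sets all pairs of points on the
  same vertical line are ordered alike.\<close>

definition below :: "real \<Rightarrow> (real^2) set \<Rightarrow> (real^2) set \<Rightarrow> bool" where
  "below x A B \<longleftrightarrow> (\<exists>p\<in>A. \<exists>q\<in>B. p$1 = x \<and> q$1 = x \<and> p$2 < q$2)"

definition meets_line :: "real \<Rightarrow> (real^2) set \<Rightarrow> bool" where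
  "meets_line x A \<longleftrightarrow> (\<exists>p\<in>A. p$1 = x)"

lemma vec2_eqI: "p$1 = q$1 \<Longrightarrow> p$2 = q$2 \<Longrightarrow> p = (q :: 'a^2)"
  by (simp add: vec_eq_iff forall_2)

lemma below_meets: "below x A B \<Longrightarrow> meets_line x A \<and> meets_line x B"
  by (auto simp: below_def meets_line_def)

lemma below_total:
  assumes "A \<inter> B = {}" "meets_line x A" "meets_line x B"
  shows "below x A B \<or> below x B A"
proof -
  obtain p q where "p \<in> A" "q \<in> B" "p$1 = x" "q$1 = x" using assms by (auto simp: meets_line_def)
  moreover have "p$2 \<noteq> q$2" using calculation assms(1) vec2_eqI[of p q] by auto
  ultimately show ?thesis unfolding below_def by (metis linorder_neqE)
qed

text \<open>If the vertical order were reversed between two lines, the segments spanned in \<open>A\<close> and in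
  \<open>B\<close> would cross.\<close>

lemma below_not_reversed:
  assumes "convex A" "convex B" "A \<inter> B = {}" "below x A B"
  shows "\<not> below y B A"
proof
  assume "below y B A"
  then obtain p' q' where 1: "p' \<in> A" "q' \<in> B" "p'$1 = y" "q'$1 = y" "q'$2 < p'$2"
    by (auto simp: below_def)
  obtain p q where 2: "p \<in> A" "q \<in> B" "p$1 = x" "q$1 = x" "p$2 < q$2"
    using assms(4) by (auto simp: below_def)
  define a where "a = q$2 - p$2"
  define b where "b = p'$2 - q'$2"
  have ab: "a > 0" "b > 0" using 1 2 by (auto simp: a_def b_def)
  define u where "u = b / (a + b)"
  define v where "v = a / (a + b)"
  have uv: "u \<ge> 0" "v \<ge> 0" "u + v = 1" "v * b = u * a"
    using ab by (auto simp: u_def v_def add_divide_distrib[symmetric] add.commute)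
  have "u *\<^sub>R p + v *\<^sub>R p' \<in> A" "u *\<^sub>R q + v *\<^sub>R q' \<in> B"
    using convexD[OF assms(1) 1(1)] convexD[OF assms(1)] convexD[OF assms(2)] 1 2 uv by auto
  moreover have "u *\<^sub>R p + v *\<^sub>R p' = u *\<^sub>R q + v *\<^sub>R q'"
    by (rule vec2_eqI) (use 1 2 uv(4) in \<open>auto simp: a_def b_def algebra_simps\<close>)
  ultimately show False using assms(3) by auto
qed

lemma convex_coefficients:
  fixes a b c :: real
  assumes "a < b" "a \<le> c" "c \<le> b"
  obtains u v where "u \<ge> 0" "v \<ge> 0" "u + v = 1" "u * a + v * b = c"
proof
  have "(b - c) / (b - a) * a + (c - a) / (b - a) * b = ((b - c) * a + (c - a) * b) / (b - a)"
    by (simp add: add_divide_distrib)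
  also have "(b - c) * a + (c - a) * b = c * (b - a)" by algebra
  finally show "(b - c) / (b - a) * a + (c - a) / (b - a) * b = c" using assms by simp
qed (use assms in \<open>auto simp: add_divide_distrib[symmetric]\<close>)

lemma mem_vertical_segment:
  assumes "convex B" "p \<in> B" "q \<in> B" "p$1 = x" "q$1 = x" "r$1 = x" "p$2 \<le> r$2" "r$2 \<le> q$2"
  shows "(r :: real^2) \<in> B"
proof (cases "p$2 = q$2")
  case True
  then have "r = p" using assms by (intro vec2_eqI) auto
  then show ?thesis using assms by simp
next
  case False
  then have "p$2 < q$2" using assms by simp
  then obtain u v where uv: "u \<ge> 0" "v \<ge> 0" "u + v = 1" and "u * p$2 + v * q$2 = r$2"
    using assms convex_coefficients by blast
  then have "u *\<^sub>R p + v *\<^sub>R q = r"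
    by (intro vec2_eqI) (use assms uv in \<open>auto simp: distrib_right[symmetric]\<close>)
  then show ?thesis using convexD[OF assms(1-3) uv] by simp
qed

text \<open>The two witnesses in \<open>B\<close> may differ. If the point of \<open>C\<close> were
  not above the witness next to \<open>A\<close>, it would lie on a vertical segment between two
  points of \<open>B\<close>.\<close>

lemma below_trans:
  assumes "convex B" "B \<inter> C = {}" "below x A B" "below x B C"
  shows "below x A C"
proof -
  obtain p q q' r where *: "p \<in> A" "q \<in> B" "q' \<in> B" "r \<in> C" "p$1 = x" "q$1 = x" "q'$1 = x" "r$1 = x"
    "p$2 < q$2" "q'$2 < r$2"
    using assms(3,4) by (auto simp: below_def)
  have "\<not> r$2 \<le> q$2"
    using mem_vertical_segment[OF assms(1) *(3,2,7,6,8)] * assms(2) by auto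
  then show ?thesis using * unfolding below_def by (intro bexI[of _ p] bexI[of _ r]) auto
qed

lemma meets_line_between:
  assumes "convex A" "meets_line x A" "meets_line z A" "x \<le> y" "y \<le> z"
  shows "meets_line y A"
proof (cases "x = z")
  case True
  then show ?thesis using assms by simp
next
  case False
  obtain p q where pq: "p \<in> A" "q \<in> A" "p$1 = x" "q$1 = z" using assms by (auto simp: meets_line_def)
  have "x < z" using False assms by simp
  then obtain u v where uv: "u \<ge> 0" "v \<ge> 0" "u + v = 1" and "u * x + v * z = y"
    using assms convex_coefficients by blast
  then have "(u *\<^sub>R p + v *\<^sub>R q)$1 = y" using pq by simp
  then show ?thesis using convexD[OF assms(1) pq(1,2) uv] unfolding meets_line_def by blast
qed

text \<open>An affine function is monotone along a vertical line. Hence a line separating a set from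
  the first obstacle above or below it also separates it from what lies behind.\<close>

lemma vertical_sign_change:
  assumes "p$1 = q$1" "q$1 = r$1" "p$2 < q$2 \<and> q$2 < r$2 \<or> r$2 < q$2 \<and> q$2 < p$2"
    and "a \<bullet> p > b" "a \<bullet> q < b"
  shows "(a :: real^2) \<bullet> r < b"
proof -
  have *: "a \<bullet> u = a$1 * u$1 + a$2 * u$2" for u by (simp add: inner_vec_def sum_2)
  have "a$2 * (q$2 - p$2) < 0" using assms(1,4,5) by (simp add: * algebra_simps)
  then have "a$2 * (r$2 - q$2) < 0" using assms(3) by (auto simp: mult_less_0_iff)
  then show ?thesis using assms(2,5) by (simp add: * algebra_simps)
qed

section \<open>The vertical order of a family and how visibilities begin\<close>

locale disjoint_convex_family =
  fixes F :: "(real^2) set set"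
  assumes fin: "finite F" and cpt: "\<And>A. A \<in> F \<Longrightarrow> compact A" and cvx: "\<And>A. A \<in> F \<Longrightarrow> convex A"
    and nonempty: "\<And>A. A \<in> F \<Longrightarrow> A \<noteq> {}" and disj: "pairwise disjnt F"
begin

lemma disjD: "A \<in> F \<Longrightarrow> B \<in> F \<Longrightarrow> A \<noteq> B \<Longrightarrow> A \<inter> B = {}"
  using disj by (auto simp: pairwise_def disjnt_def)

definition lft :: "(real^2) set \<Rightarrow> real" where "lft A = Inf ((\<lambda>p. p$1) ` A)"
definition rgt :: "(real^2) set \<Rightarrow> real" where "rgt A = Sup ((\<lambda>p. p$1) ` A)"

lemma meets_line_iff:
  assumes "A \<in> F"
  shows "meets_line x A \<longleftrightarrow> lft A \<le> x \<and> x \<le> rgt A"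
proof -
  let ?X = "(\<lambda>p. p$1) ` A"
  have c: "compact ?X" using cpt[OF assms] by (intro compact_continuous_image continuous_intros)
  have ne: "?X \<noteq> {}" using nonempty[OF assms] by simp
  have bdd: "closed ?X" "bdd_below ?X" "bdd_above ?X"
    using c by (auto intro: compact_imp_closed compact_imp_bounded bounded_imp_bdd_below bounded_imp_bdd_above)
  then have "lft A \<in> ?X" "rgt A \<in> ?X"
    unfolding lft_def rgt_def using ne by (blast intro: closed_contains_Inf closed_contains_Sup)+
  then have "meets_line (lft A) A" "meets_line (rgt A) A"
    by (auto simp: meets_line_def)
  then have "meets_line x A" if "lft A \<le> x" "x \<le> rgt A"
    using that by (rule meets_line_between[OF cvx[OF assms]])
  moreover have "lft A \<le> p$1" "p$1 \<le> rgt A" if "p \<in> A" for p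
    unfolding lft_def rgt_def using that bdd
    by (auto intro!: cInf_lower cSup_upper)
  ultimately show ?thesis
    unfolding meets_line_def by blast
qed

definition lt :: "real \<Rightarrow> (real^2) set \<Rightarrow> (real^2) set \<Rightarrow> bool" where
  "lt x A B \<longleftrightarrow> A \<in> F \<and> B \<in> F \<and> A \<noteq> B \<and> below x A B"

text \<open>The covering relation of the vertical order on one line, that is, vertical
  visibility.\<close>

definition adj :: "real \<Rightarrow> (real^2) set \<Rightarrow> (real^2) set \<Rightarrow> bool" where
  "adj x A B \<longleftrightarrow> lt x A B \<and> \<not> (\<exists>C. lt x A C \<and> lt x C B)"

lemma lt_meets: "lt x A B \<Longrightarrow> meets_line x A \<and> meets_line x B"
  using below_meets by (auto simp: lt_def)

lemma lt_in: "lt x A B \<Longrightarrow> A \<in> F \<and> B \<in> F"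
  by (auto simp: lt_def)

lemma lt_not_reversed: "lt x A B \<Longrightarrow> \<not> lt y B A"
  unfolding lt_def using below_not_reversed[of A B x y] cvx disjD by metis

lemma lt_total:
  "A \<in> F \<Longrightarrow> B \<in> F \<Longrightarrow> A \<noteq> B \<Longrightarrow> meets_line x A \<Longrightarrow> meets_line x B \<Longrightarrow> lt x A B \<or> lt x B A"
  unfolding lt_def using below_total[of A B x] disjD by metis

lemma lt_trans: "lt x A B \<Longrightarrow> lt x B C \<Longrightarrow> lt x A C"
  using lt_not_reversed[of x A B x] below_trans[of B C x A] cvx disjD by (auto simp: lt_def)

text \<open>The order of two sets is the same on every vertical line that meets both, so a pair can
  be followed from line to line.\<close>

lemma lt_transfer: "lt x A B \<Longrightarrow> meets_line y A \<Longrightarrow> meets_line y B \<Longrightarrow> lt y A B"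
  using lt_total lt_not_reversed lt_def by blast

lemma adj_unique_right: "adj x A B \<Longrightarrow> adj x A B' \<Longrightarrow> B = B'"
  unfolding adj_def using lt_total[of B B' x] lt_meets lt_in by blast

lemma adj_unique_left: "adj x A B \<Longrightarrow> adj x A' B \<Longrightarrow> A = A'"
  unfolding adj_def using lt_total[of A A' x] lt_meets lt_in by blast

lemma lt_minimal:
  assumes "Y \<subseteq> F" "Y \<noteq> {}"
  obtains C where "C \<in> Y" "\<And>D. D \<in> Y \<Longrightarrow> \<not> lt x D C"
proof -
  have "finite Y" using assms(1) fin finite_subset by blast
  moreover have "asymp_on Y (lt x)" using lt_not_reversed by (auto intro: asymp_onI)
  moreover have "transp_on Y (lt x)" using lt_trans by (auto intro: transp_onI)
  ultimately obtain C where "C \<in> Y" "\<forall>D\<in>Y. D \<noteq> C \<longrightarrow> \<not> lt x D C"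
    using Finite_Set.bex_min_element[of Y "lt x"] assms(2) by blast
  then show thesis using that[of C] unfolding lt_def by blast
qed

lemma lt_maximal:
  assumes "Y \<subseteq> F" "Y \<noteq> {}"
  obtains C where "C \<in> Y" "\<And>D. D \<in> Y \<Longrightarrow> \<not> lt x C D"
proof -
  have "finite Y" using assms(1) fin finite_subset by blast
  moreover have "asymp_on Y (lt x)" using lt_not_reversed by (auto intro: asymp_onI)
  moreover have "transp_on Y (lt x)" using lt_trans by (auto intro: transp_onI)
  ultimately obtain C where "C \<in> Y" "\<forall>D\<in>Y. D \<noteq> C \<longrightarrow> \<not> lt x C D"
    using Finite_Set.bex_max_element[of Y "lt x"] assms(2) by blast
  then show thesis using that[of C] unfolding lt_def by blast
qed

text \<open>The pair that may become visible just after \<open>C\<close> ends: the set directly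
  below \<open>C\<close>, and the lowest set above \<open>C\<close> that continues further right. It
  is formulated so that \<open>C\<close> alone determines it.\<close>

definition gap_closes_at :: "(real^2) set \<Rightarrow> (real^2) set \<times> (real^2) set \<Rightarrow> bool" where
  "gap_closes_at C = (\<lambda>(A, B). adj (rgt C) A C \<and> lt (rgt C) C B \<and> rgt C < rgt B \<and>
     (\<forall>D. lt (rgt C) C D \<and> lt (rgt C) D B \<longrightarrow> rgt D \<le> rgt C))"

lemma gap_closes_at_unique:
  assumes "gap_closes_at C e" "gap_closes_at C e'" shows "e = e'"
proof -
  obtain A B A' B' where e: "e = (A, B)" "e' = (A', B')" by (cases e, cases e') auto
  have "A = A'" using adj_unique_left assms by (auto simp: gap_closes_at_def e)
  moreover have "B = B'"
  proof (rule ccontr)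
    assume "B \<noteq> B'"
    then have "lt (rgt C) B B' \<or> lt (rgt C) B' B"
      using assms lt_in lt_meets by (intro lt_total) (auto simp: gap_closes_at_def e)
    then show False using assms by (force simp: gap_closes_at_def e)
  qed
  ultimately show ?thesis by (simp add: e)
qed

text \<open>Follow a visibility between \<open>A\<close> and \<open>B\<close> to the left. It starts where \<open>A\<close> or \<open>B\<close> starts or
  where the last of the sets separating them ends; in the last case the lowest such set is charged.\<close>

lemma adj_cases:
  assumes "adj x A B"
  shows "adj (lft A) A B \<or> adj (lft B) A B \<or> (\<exists>C\<in>F. gap_closes_at C (A, B))"
proof -
  define m where "m = max (lft A) (lft B)"
  have AB: "A \<in> F" "B \<in> F" "lt x A B" using assms by (auto simp: adj_def lt_def)
  have on: "lft A \<le> x" "x \<le> rgt A" "lft B \<le> x" "x \<le> rgt B"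
    using lt_meets[OF AB(3)] AB by (auto simp: meets_line_iff)
  have active: "lt y A B" if "m \<le> y" "y \<le> x" for y
    using that on AB by (intro lt_transfer[OF AB(3)]) (auto simp: meets_line_iff m_def)
  show ?thesis
  proof (cases "adj m A B")
    case True
    then show ?thesis by (cases "lft A \<le> lft B") (auto simp: m_def max_def)
  next
    case False
    define Mid where "Mid = {C. \<exists>y. m \<le> y \<and> y \<le> x \<and> lt y A C \<and> lt y C B}"
    have "m \<le> x" using on by (simp add: m_def)
    then have "Mid \<noteq> {}"
      using False active[of m] unfolding adj_def Mid_def by blast
    moreover have "Mid \<subseteq> F" using lt_in by (auto simp: Mid_def)
    then have "finite Mid" using fin finite_subset by blast
    \<comment> \<open>A separating set that reached \<open>x\<close> would still separate there by
      \<open>lt_transfer\<close>, against the visibility at \<open>x\<close>.\<close>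
    moreover have r: "m \<le> rgt C \<and> rgt C < x" if C: "C \<in> Mid" for C
    proof -
      obtain y where y: "m \<le> y" "y \<le> x" "lt y A C" "lt y C B" using C by (auto simp: Mid_def)
      have C: "C \<in> F" "lft C \<le> y" "y \<le> rgt C"
        using lt_meets[OF y(3)] lt_in[OF y(3)] by (auto simp: meets_line_iff)
      have "rgt C < x"
      proof (rule ccontr)
        assume "\<not> rgt C < x"
        then have "meets_line x C" using C y by (simp add: meets_line_iff)
        then have "lt x A C" "lt x C B"
          using y lt_transfer lt_meets[OF AB(3)] by blast+
        then show False using assms by (auto simp: adj_def)
      qed
      then show ?thesis using C y by simp
    qed
    \<comment> \<open>The last right end of a separating set: from there up to \<open>x\<close> the
      view between \<open>A\<close> and \<open>B\<close> is free, so every set separating them at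
      \<open>z\<close> ends exactly at \<open>z\<close>.\<close>
    define z where "z = Max (rgt ` Mid)"
    ultimately have z: "z \<in> rgt ` Mid" "\<And>C. C \<in> Mid \<Longrightarrow> rgt C \<le> z"
      by (auto simp: z_def)
    have mz: "m \<le> z" "z < x" using z(1) r by auto
    define L where "L = {C. lt z A C \<and> lt z C B}"
    have LMid: "L \<subseteq> Mid" using mz by (auto simp: L_def Mid_def)
    have Lz: "rgt C = z" if "C \<in> L" for C
    proof -
      have "meets_line z C" "C \<in> F" using that lt_meets lt_in by (auto simp: L_def)
      then show ?thesis using z(2)[of C] that LMid by (auto simp: meets_line_iff)
    qed
    have "L \<noteq> {}"
    proof -
      obtain C where C: "C \<in> Mid" "rgt C = z" using z(1) by auto
      then obtain y where y: "m \<le> y" "y \<le> x" "lt y A C" "lt y C B" by (auto simp: Mid_def)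
      have "C \<in> F" "meets_line y C" using y lt_meets lt_in by auto
      then have "meets_line z C" using C by (auto simp: meets_line_iff)
      moreover have "meets_line z A" "meets_line z B"
        using active[of z] mz lt_meets by auto
      ultimately have "C \<in> L" using y lt_transfer unfolding L_def by blast
      then show ?thesis by blast
    qed
    moreover have "L \<subseteq> F" using LMid \<open>Mid \<subseteq> F\<close> by blast
    ultimately obtain C where C: "C \<in> L" "\<And>D. D \<in> L \<Longrightarrow> \<not> lt z D C"
      using lt_minimal[of L z] by blast
    have "\<not> (lt z A D \<and> lt z D C)" for D
      using C lt_trans[of z D C B] unfolding L_def by blast
    then have "adj z A C"
      using C(1) by (simp add: adj_def L_def)
    moreover have "lt z C B" "z < rgt B" using C on mz by (auto simp: L_def)
    moreover have "rgt D \<le> z" if "lt z C D" "lt z D B" for D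
      using Lz[of D] that C(1) lt_trans[of z A C D] by (auto simp: L_def)
    ultimately have "gap_closes_at C (A, B)"
      using Lz[OF C(1)] by (simp add: gap_closes_at_def)
    then show ?thesis using C(1) \<open>L \<subseteq> F\<close> by blast
  qed
qed

section \<open>Counting visible pairs\<close>

definition visible :: "((real^2) set \<times> (real^2) set) set" where
  "visible = {(A, B). \<exists>x. adj x A B}"

lemma visible_subset: "visible \<subseteq> F \<times> F"
  by (auto simp: visible_def adj_def lt_def)

text \<open>Charging by \<open>adj_cases\<close>: a member pays for at most one pair that starts at
  its left end with it as the lower set, one with it as the upper set, and one gap closed at its
  right end.\<close>

lemma card_visible: "card visible \<le> 3 * card F"
proof -
  let ?X = "{(A, B). adj (lft A) A B}"
  let ?Y = "{(A, B). adj (lft B) A B}"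
  let ?Z = "{e. \<exists>C\<in>F. gap_closes_at C e}"
  have cover: "visible \<subseteq> ?X \<union> ?Y \<union> ?Z"
    using adj_cases by (auto simp: visible_def)
  \<comment> \<open>By \<open>gap_closes_at_unique\<close> these pairs are values of a function of
    \<open>C\<close>. What \<open>SOME\<close> yields for sets closing no gap is harmless, as only
    an inclusion is claimed.\<close>
  have "?Z \<subseteq> (\<lambda>C. SOME e. gap_closes_at C e) ` F"
  proof clarify
    fix A B C assume C: "C \<in> F" "gap_closes_at C (A, B)"
    then show "(A, B) \<in> (\<lambda>C. SOME e. gap_closes_at C e) ` F"
      using gap_closes_at_unique[OF C(2), of "SOME e. gap_closes_at C e"]
        someI[of "gap_closes_at C" "(A, B)"] by auto
  qed
  then have Z: "finite ?Z" "card ?Z \<le> card F"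
    using fin finite_subset surj_card_le by blast+
  have sub: "?X \<subseteq> F \<times> F" "?Y \<subseteq> F \<times> F" by (auto simp: adj_def lt_def)
  then have XY: "finite ?X" "finite ?Y" using fin finite_subset by blast+
  have "inj_on fst ?X" "inj_on snd ?Y"
    unfolding inj_on_def by (clarsimp, blast dest: adj_unique_right, clarsimp, blast dest: adj_unique_left)
  moreover have "fst ` ?X \<subseteq> F" "snd ` ?Y \<subseteq> F"
    unfolding adj_def lt_def by (rule image_subsetI, clarsimp)+
  ultimately have "card ?X \<le> card F" "card ?Y \<le> card F"
    using card_inj_on_le[of fst ?X F] card_inj_on_le[of snd ?Y F] fin by simp_all
  moreover have "card (?X \<union> ?Y \<union> ?Z) \<le> card ?X + card ?Y + card ?Z"
    by (meson add_le_mono card_Un_le le_refl le_trans)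
  moreover have "card visible \<le> card (?X \<union> ?Y \<union> ?Z)"
    using XY Z by (intro card_mono cover) auto
  ultimately show ?thesis using Z(2) by linarith
qed

text \<open>The degrees sum to twice the number of visible pairs, so their average is at most
  6.\<close>

lemma exists_few_visible:
  assumes "F \<noteq> {}"
  obtains A N where "A \<in> F" "N \<subseteq> F - {A}" "card N \<le> 6"
    "\<And>x B. adj x A B \<or> adj x B A \<Longrightarrow> B \<in> N"
proof -
  let ?up = "\<lambda>A. {B. (A, B) \<in> visible}"
  let ?down = "\<lambda>A. {B. (B, A) \<in> visible}"
  have finv: "finite visible" using visible_subset fin finite_subset by blast
  have fup: "finite (?up A)" "finite (?down A)" for A
    using visible_subset by (auto intro!: finite_subset[OF _ fin])
  have sigma: "visible = (SIGMA A:F. ?up A)" "visible\<inverse> = (SIGMA A:F. ?down A)"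
    using visible_subset by auto
  have "card (SIGMA A:F. ?up A) = (\<Sum>A\<in>F. card (?up A))"
    "card (SIGMA A:F. ?down A) = (\<Sum>A\<in>F. card (?down A))"
    using fin fup by (intro card_SigmaI; simp)+
  then have "card visible = (\<Sum>A\<in>F. card (?up A))" "card (visible\<inverse>) = (\<Sum>A\<in>F. card (?down A))"
    using arg_cong[OF sigma(1), of card] arg_cong[OF sigma(2), of card] by presburger+
  then have "(\<Sum>A\<in>F. card (?up A) + card (?down A)) = 2 * card visible"
    by (simp add: sum.distrib card_inverse)
  then have sum: "(\<Sum>A\<in>F. card (?up A) + card (?down A)) \<le> 6 * card F"
    using card_visible by simp
  have "\<exists>A\<in>F. card (?up A) + card (?down A) \<le> 6"
  proof (rule ccontr)
    assume "\<not> ?thesis"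
    then have "\<And>A. A \<in> F \<Longrightarrow> 7 \<le> card (?up A) + card (?down A)" by force
    then have "card F * 7 \<le> (\<Sum>A\<in>F. card (?up A) + card (?down A))"
      using sum_bounded_below[of F 7 "\<lambda>A. card (?up A) + card (?down A)"] by simp
    then show False using sum assms fin card_gt_0_iff[of F] by linarith
  qed
  then obtain A where A: "A \<in> F" "card (?up A) + card (?down A) \<le> 6" by blast
  show thesis
  proof (rule that[of A "?up A \<union> ?down A"])
    show "?up A \<union> ?down A \<subseteq> F - {A}" by (auto simp: visible_def adj_def lt_def)
    show "card (?up A \<union> ?down A) \<le> 6" using A(2) card_Un_le le_trans by blast
  qed (use A in \<open>auto simp: visible_def\<close>)
qed

section \<open>From visibility to separating lines\<close>

lemma visible_on_ray:
  assumes "lt x A D"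
  obtains B where "adj x A B" "B = D \<or> lt x B D"
proof -
  let ?Y = "{B. lt x A B \<and> (B = D \<or> lt x B D)}"
  have "?Y \<subseteq> F" "?Y \<noteq> {}" using assms by (auto simp: lt_def)
  then obtain B where B: "B \<in> ?Y" "\<And>D. D \<in> ?Y \<Longrightarrow> \<not> lt x D B" using lt_minimal[of ?Y x] by blast
  have "\<not> (lt x A C \<and> lt x C B)" for C
    using B lt_trans[of x C B D] by blast
  then have "adj x A B" using B(1) by (auto simp: adj_def)
  then show thesis using that B by blast
qed

lemma visible_on_ray_down:
  assumes "lt x D A"
  obtains B where "adj x B A" "B = D \<or> lt x D B"
proof -
  let ?Y = "{B. lt x B A \<and> (B = D \<or> lt x D B)}"
  have "?Y \<subseteq> F" "?Y \<noteq> {}" using assms by (auto simp: lt_def)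
  then obtain B where B: "B \<in> ?Y" "\<And>D. D \<in> ?Y \<Longrightarrow> \<not> lt x B D" using lt_maximal[of ?Y x] by blast
  have "\<not> (lt x B C \<and> lt x C A)" for C
    using B lt_trans[of x D B C] by blast
  then have "adj x B A" using B(1) by (auto simp: adj_def)
  then show thesis using that B by blast
qed

text \<open>\<open>B\<close> is the first set met on the vertical way from \<open>A\<close> to
  \<open>p\<close>. Either it contains \<open>p\<close>, or it lies between; in both cases a line
  with \<open>A\<close> and \<open>B\<close> on different sides has \<open>p\<close> on the side of
  \<open>B\<close>.\<close>

lemma visible_from_point:
  assumes "A \<in> F" "D \<in> F" "D \<noteq> A" "p \<in> D" "q \<in> A" "q$1 = p$1"
  shows "\<exists>x B. (adj x A B \<or> adj x B A) \<and>
    (\<forall>a b. (\<forall>y\<in>A. a \<bullet> y > b) \<longrightarrow> (\<forall>y\<in>B. a \<bullet> y < b) \<longrightarrow> a \<bullet> p < b)"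
proof -
  have "lt (p$1) A D \<or> lt (p$1) D A"
    using assms by (intro lt_total) (auto simp: meets_line_def)
  then obtain B where B: "adj (p$1) A B \<and> (B = D \<or> lt (p$1) B D) \<or> adj (p$1) B A \<and> (B = D \<or> lt (p$1) D B)"
    using visible_on_ray visible_on_ray_down by metis
  have in_F: "B \<in> F" "B \<noteq> A" using B by (auto simp: adj_def lt_def)
  show ?thesis
  proof (intro exI conjI allI impI)
    fix a :: "real^2" and b
    assume above: "\<forall>y\<in>A. a \<bullet> y > b" and under: "\<forall>y\<in>B. a \<bullet> y < b"
    show "a \<bullet> p < b"
    proof (cases "B = D")
      case True
      then show ?thesis using under assms by simp
    next
      case False
      have "meets_line (p$1) B" using B lt_meets by (auto simp: adj_def)
      then obtain r where r: "r \<in> B" "r$1 = p$1" by (auto simp: meets_line_def)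
      have ne: "q$2 \<noteq> r$2" "r$2 \<noteq> p$2"
        using vec2_eqI[of q r] vec2_eqI[of r p] r assms False in_F disjD[of A B] disjD[of B D] by auto
      have "lt (p$1) X Y" if "u \<in> X" "v \<in> Y" "u$1 = p$1" "v$1 = p$1" "u$2 < v$2" "X \<in> F" "Y \<in> F" "X \<noteq> Y"
        for X Y u v using that unfolding lt_def below_def by blast
      note pos = this
      have "q$2 < r$2 \<and> r$2 < p$2 \<or> p$2 < r$2 \<and> r$2 < q$2"
      proof (cases "adj (p$1) A B \<and> lt (p$1) B D")
        case True
        then have "\<not> r$2 < q$2" "\<not> p$2 < r$2"
          using pos[of r B q A] pos[of p D r B] r assms in_F False lt_not_reversed unfolding adj_def by blast+
        then show ?thesis using ne by auto
      next
        case F: False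
        then have "\<not> q$2 < r$2" "\<not> r$2 < p$2"
          using B pos[of q A r B] pos[of r B p D] r assms in_F False lt_not_reversed unfolding adj_def by blast+
        then show ?thesis using ne by auto
      qed
      then show ?thesis
        using vertical_sign_change[of q r p b a] r assms above under by auto
    qed
  qed (use B in blast)
qed

text \<open>Points on vertical lines missing \<open>A\<close> are excluded by the strip around
  \<open>A\<close>, all others by a line towards one of the at most 6 visible sets; this gives
  8.\<close>

lemma exists_polygonal_separation:
  assumes "F \<noteq> {}"
  obtains A N where "A \<in> F" "finite N" "card N \<le> 8" "\<And>p a b. p \<in> A \<Longrightarrow> (a, b) \<in> N \<Longrightarrow> a \<bullet> p \<ge> b"
    "\<And>p D. D \<in> F \<Longrightarrow> D \<noteq> A \<Longrightarrow> p \<in> D \<Longrightarrow> \<exists>(a, b)\<in>N. a \<bullet> p < b"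
proof -
  obtain A N where A: "A \<in> F" and N: "N \<subseteq> F - {A}" "card N \<le> 6"
    and vis: "\<And>x B. adj x A B \<or> adj x B A \<Longrightarrow> B \<in> N"
    using exists_few_visible[OF assms] by blast
  have finN: "finite N" using N fin finite_subset by blast
  have "\<forall>B\<in>N. \<exists>e. (\<forall>y\<in>A. fst e \<bullet> y > snd e) \<and> (\<forall>y\<in>B. fst e \<bullet> y < snd e)"
  proof
    fix B assume "B \<in> N"
    then have B: "B \<in> F" "B \<inter> A = {}" using N disjD A by auto
    obtain a b where "\<forall>y\<in>B. a \<bullet> y < b" "\<forall>y\<in>A. a \<bullet> y > b"
      using separating_hyperplane_closed_compact[of B A] B A cvx cpt nonempty compact_imp_closed by metis
    then show "\<exists>e. (\<forall>y\<in>A. fst e \<bullet> y > snd e) \<and> (\<forall>y\<in>B. fst e \<bullet> y < snd e)"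
      by (intro exI[of _ "(a, b)"]) simp
  qed
  then obtain h where h: "\<And>B y. B \<in> N \<Longrightarrow> y \<in> A \<Longrightarrow> fst (h B) \<bullet> y > snd (h B)"
    "\<And>B y. B \<in> N \<Longrightarrow> y \<in> B \<Longrightarrow> fst (h B) \<bullet> y < snd (h B)"
    unfolding bchoice_iff by blast
  \<comment> \<open>A pair \<open>(a, b)\<close> stands for the closed halfplane where the inner
    product with \<open>a\<close> is at least \<open>b\<close>. The normals \<open>?e\<close> and
    \<open>- ?e\<close> give the strip, whose boundary lines touch \<open>A\<close>; hence the weak
    inequality on \<open>A\<close>.\<close>
  let ?e = "axis 1 1 :: real^2"
  let ?M = "insert (?e, lft A) (insert (- ?e, - rgt A) (h ` N))"
  have e: "?e \<bullet> y = y$1" for y by (simp add: inner_axis')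
  have range: "(lft A \<le> x \<and> x \<le> rgt A) \<longleftrightarrow> (\<exists>q\<in>A. q$1 = x)" for x
    using meets_line_iff[OF A] by (simp add: meets_line_def)
  show thesis
  proof (rule that[of A ?M])
    show "card ?M \<le> 8"
      using card_image_le[OF finN, of h] N(2) finN by (simp add: card_insert_if)
    show "a \<bullet> p \<ge> b" if "p \<in> A" "(a, b) \<in> ?M" for p a b
    proof -
      have "lft A \<le> p$1 \<and> p$1 \<le> rgt A" using range that(1) by blast
      then show ?thesis using that h(1)[OF _ that(1)] by (auto simp: e inner_minus_left) (metis fst_conv snd_conv less_imp_le)
    qed
    show "\<exists>(a, b)\<in>?M. a \<bullet> p < b" if D: "D \<in> F" "D \<noteq> A" "p \<in> D" for p D
    proof (cases "lft A \<le> p$1 \<and> p$1 \<le> rgt A")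
      case False
      then show ?thesis by (auto simp: e inner_minus_left)
    next
      case True
      then obtain q where "q \<in> A" "q$1 = p$1" using range by blast
      from visible_from_point[OF A D(1,2,3) this] obtain x B where
        "adj x A B \<or> adj x B A" and
        B: "\<And>a b. \<forall>y\<in>A. a \<bullet> y > b \<Longrightarrow> \<forall>y\<in>B. a \<bullet> y < b \<Longrightarrow> a \<bullet> p < b"
        by blast
      then have "B \<in> N" using vis by blast
      then have "fst (h B) \<bullet> p < snd (h B)" using h by (intro B) auto
      then show ?thesis using \<open>B \<in> N\<close> by (intro bexI[of _ "h B"]) (auto simp: case_prod_beta)
    qed
  qed (use A finN in auto)
qed

end

section \<open>Balance of halfplane cuts\<close>

text \<open>The lines are kept off the points, so that the complement of a cut is again a cut.\<close>

definition halfplane_cut :: "(real^2) set \<Rightarrow> (real^2) set \<Rightarrow> bool" where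
  "halfplane_cut S H \<longleftrightarrow> (\<exists>a b. (\<forall>x\<in>S. a \<bullet> x \<noteq> b) \<and> H = {x\<in>S. a \<bullet> x > b})"

lemma halfplane_cut_subset: "halfplane_cut S H \<Longrightarrow> H \<subseteq> S"
  by (auto simp: halfplane_cut_def)

lemma halfplane_cut_Diff: "halfplane_cut S H \<Longrightarrow> halfplane_cut S (S - H)"
  unfolding halfplane_cut_def
proof (elim exE conjE)
  fix a :: "real^2" and b assume "\<forall>x\<in>S. a \<bullet> x \<noteq> b" "H = {x\<in>S. a \<bullet> x > b}"
  then show "\<exists>a b. (\<forall>x\<in>S. a \<bullet> x \<noteq> b) \<and> S - H = {x\<in>S. a \<bullet> x > b}"
    by (intro exI[of _ "- a"] exI[of _ "- b"]) force
qed

lemma halfplane_cut_self: "halfplane_cut S S"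
  unfolding halfplane_cut_def by (intro exI[of _ 0] exI[of _ "-1"]) auto

lemma halfplane_cut_greater:
  assumes "finite S"
  shows "halfplane_cut S {x\<in>S. a \<bullet> x > b}"
proof -
  \<comment> \<open>The least value above \<open>b\<close> taken on \<open>S\<close>; inserting
    \<open>b + 1\<close> keeps the minimum defined if there is none. The midpoint of
    \<open>b\<close> and \<open>m\<close> is then avoided by all points.\<close>
  define m where "m = Min (insert (b + 1) ((\<bullet>) a ` {x\<in>S. a \<bullet> x > b}))"
  have m: "m > b" "\<And>x. x \<in> S \<Longrightarrow> a \<bullet> x > b \<Longrightarrow> m \<le> a \<bullet> x"
    using assms by (auto simp: m_def)
  then have *: "x \<in> S \<Longrightarrow> (b + m) / 2 < a \<bullet> x \<longleftrightarrow> b < a \<bullet> x" "x \<in> S \<Longrightarrow> (b + m) / 2 \<noteq> a \<bullet> x" for x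
    by (force simp: field_simps)+
  show ?thesis
    unfolding halfplane_cut_def by (intro exI[of _ a] exI[of _ "(b + m) / 2"]) (use * in force)
qed

lemma halfplane_cut_ge:
  assumes "finite S"
  shows "halfplane_cut S {x\<in>S. a \<bullet> x \<ge> b}"
proof -
  have "S - {x\<in>S. (- a) \<bullet> x > - b} = {x\<in>S. a \<bullet> x \<ge> b}" by auto
  then show ?thesis using halfplane_cut_Diff[OF halfplane_cut_greater[OF assms, where a = "- a" and b = "- b"]] by simp
qed

text \<open>Three affine functions of the plane are dependent modulo constants, which excludes one of the
  eight sign patterns.\<close>

lemma halfplane_cuts_missing_cell:
  assumes "halfplane_cut S H1" "halfplane_cut S H2" "halfplane_cut S H3"
  obtains E1 E2 E3 where "E1 \<in> {H1, S - H1}" "E2 \<in> {H2, S - H2}" "E3 \<in> {H3, S - H3}" "E1 \<inter> E2 \<inter> E3 = {}"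
proof -
  obtain a1 b1 where 1: "\<forall>x\<in>S. a1 \<bullet> x \<noteq> b1" "H1 = {x\<in>S. a1 \<bullet> x > b1}" using assms by (auto simp: halfplane_cut_def)
  obtain a2 b2 where 2: "\<forall>x\<in>S. a2 \<bullet> x \<noteq> b2" "H2 = {x\<in>S. a2 \<bullet> x > b2}" using assms by (auto simp: halfplane_cut_def)
  obtain a3 b3 where 3: "\<forall>x\<in>S. a3 \<bullet> x \<noteq> b3" "H3 = {x\<in>S. a3 \<bullet> x > b3}" using assms by (auto simp: halfplane_cut_def)
  have "\<exists>u v w. (u, v, w) \<noteq> (0, 0, 0) \<and> u *\<^sub>R a1 + v *\<^sub>R a2 + w *\<^sub>R a3 = 0"
  \<comment> \<open>The 2x2 minors are the coefficients of a dependence. If all of them vanish,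
    either \<open>a1\<close> is zero or \<open>a1\<close> and \<open>a2\<close> are already
    dependent.\<close>
  proof (cases "a1$1 * a2$2 = a1$2 * a2$1 \<and> a2$1 * a3$2 = a2$2 * a3$1 \<and> a3$1 * a1$2 = a3$2 * a1$1")
    case False
    then show ?thesis
      by (intro exI[of _ "a2$1 * a3$2 - a2$2 * a3$1"] exI[of _ "a3$1 * a1$2 - a3$2 * a1$1"]
          exI[of _ "a1$1 * a2$2 - a1$2 * a2$1"] conjI vec2_eqI) (auto simp: algebra_simps)
  next
    case True
    show ?thesis
    proof (cases "a1 = 0")
      case True
      then show ?thesis by (intro exI[of _ 1] exI[of _ 0]) auto
    next
      case False
      have "a2$1 * a1$2 = a1$1 * a2$2" using True by simp
      then have "- (a1 \<bullet> a2) * a1$1 + (a1 \<bullet> a1) * a2$1 = 0" "- (a1 \<bullet> a2) * a1$2 + (a1 \<bullet> a1) * a2$2 = 0"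
        unfolding inner_vec_def sum_2 inner_real_def by algebra+
      then show ?thesis
        using False by (intro exI[of _ "- (a1 \<bullet> a2)"] exI[of _ "a1 \<bullet> a1"] exI[of _ 0] conjI vec2_eqI) auto
    qed
  qed
  \<comment> \<open>Negating all coefficients if necessary fixes the sign of the combined constant,
    which decides which of two opposite cells is empty.\<close>
  then obtain u v w where dep: "(u, v, w) \<noteq> (0, 0, 0)" "u *\<^sub>R a1 + v *\<^sub>R a2 + w *\<^sub>R a3 = 0"
    and sign: "u * b1 + v * b2 + w * b3 \<ge> 0"
  proof -
    from \<open>\<exists>u v w. _\<close> obtain u v w where *: "(u, v, w) \<noteq> (0, 0, 0)" "u *\<^sub>R a1 + v *\<^sub>R a2 + w *\<^sub>R a3 = 0" by blast
    have "(- u) *\<^sub>R a1 + (- v) *\<^sub>R a2 + (- w) *\<^sub>R a3 = - (u *\<^sub>R a1 + v *\<^sub>R a2 + w *\<^sub>R a3)" by simp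
    with * show thesis using that[of u v w] that[of "- u" "- v" "- w"]
      by (cases "u * b1 + v * b2 + w * b3 \<ge> 0") auto
  qed
  have pos: "t * (a \<bullet> x - b) \<ge> 0 \<and> (t \<noteq> 0 \<longrightarrow> t * (a \<bullet> x - b) > 0)"
    if "\<forall>x\<in>S. a \<bullet> x \<noteq> b" "H = {x\<in>S. a \<bullet> x > b}" "x \<in> (if t > 0 then H else S - H)"
    for t b x H and a :: "real^2"
  proof -
    have "a \<bullet> x \<noteq> b" using that by (auto split: if_splits)
    then show ?thesis using that
      by (cases t "0 :: real" rule: linorder_cases) (auto simp: zero_le_mult_iff zero_less_mult_iff)
  qed
  \<comment> \<open>In this cell every term \<open>t * (a \<bullet> x - b)\<close> is nonnegative
    and one is positive, whereas by the dependence they add up to minus the constant. For a zero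
    coefficient either side would do.\<close>
  let ?E = "\<lambda>t H. if t > (0 :: real) then H else S - H"
  have "?E u H1 \<inter> ?E v H2 \<inter> ?E w H3 = {}"
  proof (rule ccontr)
    assume "?E u H1 \<inter> ?E v H2 \<inter> ?E w H3 \<noteq> {}"
    then obtain x where x: "x \<in> ?E u H1" "x \<in> ?E v H2" "x \<in> ?E w H3" by blast
    have "u * (a1 \<bullet> x - b1) + v * (a2 \<bullet> x - b2) + w * (a3 \<bullet> x - b3) > 0"
      using pos[OF 1 x(1)] pos[OF 2 x(2)] pos[OF 3 x(3)] dep(1) by (smt (verit) prod.inject)
    moreover have "u * (a1 \<bullet> x) + v * (a2 \<bullet> x) + w * (a3 \<bullet> x) = (u *\<^sub>R a1 + v *\<^sub>R a2 + w *\<^sub>R a3) \<bullet> x"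
      by (simp add: inner_add_left)
    then have "u * (a1 \<bullet> x) + v * (a2 \<bullet> x) + w * (a3 \<bullet> x) = 0" by (simp only: dep(2) inner_zero_left)
    ultimately show False using sign by (simp add: algebra_simps)
  qed
  then show thesis by (intro that[of "?E u H1" "?E v H2" "?E w H3"]) auto
qed

section \<open>The balance of intersections of cuts\<close>

text \<open>\<open>disc\<close> without the absolute value, hence additive over disjoint
  unions.\<close>

definition balance :: "'a set \<Rightarrow> 'a set \<Rightarrow> 'a set \<Rightarrow> int" where
  "balance R B Y = int (card (Y \<inter> R)) - int (card (Y \<inter> B))"

lemma disc_eq_abs_balance: "disc R B Y = \<bar>balance R B Y\<bar>"
  by (simp add: disc_def balance_def)

lemma balance_empty [simp]: "balance R B {} = 0"
  by (simp add: balance_def)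

lemma abs_balance_le_card: "finite Y \<Longrightarrow> \<bar>balance R B Y\<bar> \<le> int (card Y)"
  using card_mono[of Y "Y \<inter> R"] card_mono[of Y "Y \<inter> B"] by (simp add: balance_def)

lemma balance_Int_Un: "balance R B (Y \<inter> (R \<union> B)) = balance R B Y"
proof -
  have "Y \<inter> (R \<union> B) \<inter> R = Y \<inter> R" "Y \<inter> (R \<union> B) \<inter> B = Y \<inter> B" by auto
  then show ?thesis by (simp add: balance_def)
qed

text \<open>Twice the signed area of the triangle \<open>p q x\<close>, positive when
  \<open>x\<close> is to the left of the directed line from \<open>p\<close> to \<open>q\<close>. It
  vanishes for \<open>p = q\<close>, so degenerate quadruples give empty wedges.\<close>

definition orient :: "real^2 \<Rightarrow> real^2 \<Rightarrow> real^2 \<Rightarrow> real" where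
  "orient p q x = (q$1 - p$1) * (x$2 - p$2) - (q$2 - p$2) * (x$1 - p$1)"

definition wedge :: "real^2 \<Rightarrow> real^2 \<Rightarrow> real^2 \<Rightarrow> real^2 \<Rightarrow> (real^2) set" where
  "wedge p q r s = {x. 0 < orient p q x \<and> 0 < orient r s x}"

locale bicolored =
  fixes R B :: "(real^2) set"
  assumes finite_R: "finite R" and finite_B: "finite B" and disjoint: "R \<inter> B = {}"
    and nonempty: "R \<union> B \<noteq> {}" and general: "general_position (R \<union> B)"
begin

abbreviation "S \<equiv> R \<union> B"
abbreviation "bal \<equiv> balance R B"
abbreviation "hcut \<equiv> halfplane_cut S"
abbreviation "coarse \<equiv> coarseness R B"

lemma finite_S: "finite S" using finite_R finite_B by simp

lemma balance_Un: "X \<inter> Y = {} \<Longrightarrow> bal (X \<union> Y) = bal X + bal Y"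
  using finite_R finite_B
  by (simp add: balance_def Int_Un_distrib2 card_Un_disjoint disjoint_iff)

lemma balance_split: "bal X = bal (X \<inter> H) + bal (X - H)"
  using balance_Un[of "X \<inter> H" "X - H"] by (simp add: Int_Diff_Un Int_Diff_disjoint)

lemma balance_complement: "X \<subseteq> S \<Longrightarrow> bal X = bal (X \<inter> H) + bal (X \<inter> (S - H))"
proof -
  assume "X \<subseteq> S"
  then have "X \<inter> (S - H) = X - H" by auto
  then show "bal X = bal (X \<inter> H) + bal (X \<inter> (S - H))" using balance_split[of X H] by (simp only:)
qed

text \<open>Flip the three cuts one after the other to the sides of the missing cell. Each flip
  costs the balance of \<open>T\<close> with the two other current cuts, at most \<open>m\<close>,
  and the last cell is empty.\<close>

lemma halfplane_cuts_Int3: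
  assumes cuts: "hcut H1" "hcut H2" "hcut H3" and T: "T \<subseteq> S"
    and bound: "\<And>E E'. hcut E \<Longrightarrow> hcut E' \<Longrightarrow> \<bar>bal (T \<inter> E \<inter> E')\<bar> \<le> m"
  shows "\<bar>bal (T \<inter> H1 \<inter> H2 \<inter> H3)\<bar> \<le> 3 * m"
proof -
  obtain E1 E2 E3 where E: "E1 \<in> {H1, S - H1}" "E2 \<in> {H2, S - H2}" "E3 \<in> {H3, S - H3}" "E1 \<inter> E2 \<inter> E3 = {}"
    using halfplane_cuts_missing_cell[OF cuts] by blast
  have flip: "\<bar>bal (X \<inter> H)\<bar> \<le> \<bar>bal X\<bar> + \<bar>bal (X \<inter> E)\<bar>" if "E \<in> {H, S - H}" "X \<subseteq> S" for X H E
    using balance_complement[OF that(2), of H] that(1) by auto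
  have cutE: "hcut E3" "hcut E2" using E cuts halfplane_cut_Diff by auto
  have "\<bar>bal (T \<inter> H1 \<inter> H2 \<inter> H3)\<bar> \<le> m + \<bar>bal (T \<inter> H1 \<inter> H2 \<inter> E3)\<bar>"
    using flip[OF E(3), of "T \<inter> H1 \<inter> H2"] bound[of H1 H2] cuts T by fastforce
  moreover have "\<bar>bal (T \<inter> H1 \<inter> E3 \<inter> H2)\<bar> \<le> m + \<bar>bal (T \<inter> H1 \<inter> E3 \<inter> E2)\<bar>"
    using flip[OF E(2), of "T \<inter> H1 \<inter> E3"] bound[of H1 E3] cuts cutE T by fastforce
  moreover have "\<bar>bal (T \<inter> E2 \<inter> E3 \<inter> H1)\<bar> \<le> m + \<bar>bal (T \<inter> E2 \<inter> E3 \<inter> E1)\<bar>"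
    using flip[OF E(1), of "T \<inter> E2 \<inter> E3"] bound[of E2 E3] cutE T by fastforce
  moreover have "T \<inter> E2 \<inter> E3 \<inter> E1 = {}" using E(4) by blast
  moreover have "T \<inter> H1 \<inter> H2 \<inter> E3 = T \<inter> H1 \<inter> E3 \<inter> H2" "T \<inter> H1 \<inter> E3 \<inter> E2 = T \<inter> E2 \<inter> E3 \<inter> H1" by blast+
  ultimately show ?thesis by simp
qed

text \<open>Three cuts of the list are traded for two arbitrary ones, so the induction runs over
  lengths and covers all lists of cuts.\<close>

lemma balance_Int_cuts:
  assumes bound: "\<And>E E'. hcut E \<Longrightarrow> hcut E' \<Longrightarrow> \<bar>bal (E \<inter> E')\<bar> \<le> m"
    and "\<forall>H\<in>set Hs. hcut H"
  shows "\<bar>bal (S \<inter> \<Inter>(set Hs))\<bar> \<le> 3 ^ length Hs * m"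
  using assms(2)
proof (induction Hs rule: length_induct)
  case (1 Hs)
  have "0 \<le> m" using bound[OF halfplane_cut_self halfplane_cut_self] by linarith
  then have le: "m \<le> 3 ^ k * m" for k :: nat
    using mult_right_mono[of 1 "3 ^ k" m] by simp
  show ?case
  proof (cases "length Hs \<le> 2")
    case True
    \<comment> \<open>Lists of at most two cuts are filled up with \<open>S\<close>.\<close>
    then obtain H H' where "hcut H" "hcut H'" "S \<inter> \<Inter>(set Hs) = H \<inter> H'"
    proof (cases Hs rule: remdups_adj.cases)
      case 1
      then show thesis using that[of S S] halfplane_cut_self by auto
    next
      case (2 H)
      then show thesis using that[of H S] "1.prems" halfplane_cut_self by auto
    next
      case (3 H H' Hs')
      then have "S \<inter> \<Inter>(set Hs) = H \<inter> H'"
        using True "1.prems" halfplane_cut_subset[of S H] by auto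
      then show thesis using that 3 "1.prems" by auto
    qed
    then show ?thesis using bound le order_trans by metis
  next
    case False
    then obtain H1 H2 H3 Ts where Hs: "Hs = H1 # H2 # H3 # Ts"
      by (auto simp: neq_Nil_conv not_le numeral_2_eq_2 Suc_less_eq2 length_Suc_conv less_Suc_eq_le Suc_le_length_iff)
    let ?T = "S \<inter> \<Inter>(set Ts)"
    have "\<bar>bal (?T \<inter> H1 \<inter> H2 \<inter> H3)\<bar> \<le> 3 * (3 ^ (length Ts + 2) * m)"
    proof (rule halfplane_cuts_Int3)
      fix E E' assume E: "hcut E" "hcut E'"
      have "length (E # E' # Ts) < length Hs" by (simp add: Hs)
      moreover have "\<forall>H\<in>set (E # E' # Ts). hcut H" using E "1.prems" by (auto simp: Hs)
      ultimately have "\<bar>bal (S \<inter> \<Inter>(set (E # E' # Ts)))\<bar> \<le> 3 ^ length (E # E' # Ts) * m"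
        using 1(1) by blast
      then show "\<bar>bal (?T \<inter> E \<inter> E')\<bar> \<le> 3 ^ (length Ts + 2) * m"
        by (simp add: Int_ac)
    qed (use "1.prems" Hs in auto)
    then show ?thesis by (simp add: Hs Int_ac)
  qed
qed

section \<open>Convex partitions\<close>

lemma coarse_ge:
  assumes "convex_partition S P" "\<And>Y. Y \<in> P \<Longrightarrow> k \<le> disc R B Y"
  shows "k \<le> coarse"
proof -
  have "k \<le> partition_disc R B P"
    unfolding partition_disc_def
    using assms convex_partition_finite_nonempty[OF assms(1) finite_S nonempty] by (intro Min.boundedI) auto
  also have "\<dots> \<le> coarse"
    unfolding coarseness_def using finite_convex_partitions[OF finite_S] assms(1) by (intro Max_ge) auto
  finally show ?thesis .
qed

lemma coarse_attained:
  obtains P where "convex_partition S P" "\<And>Y. Y \<in> P \<Longrightarrow> coarse \<le> disc R B Y"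
proof -
  have "coarse \<in> partition_disc R B ` {P. convex_partition S P}"
    unfolding coarseness_def
    using finite_convex_partitions[OF finite_S] convex_partition_trivial[OF nonempty] by (intro Max_in) auto
  then obtain P where P: "convex_partition S P" "coarse = partition_disc R B P" by auto
  then have "coarse \<le> disc R B Y" if "Y \<in> P" for Y
    using convex_partition_finite_nonempty[OF P(1) finite_S nonempty] that
    by (simp add: partition_disc_def)
  then show thesis using that P by blast
qed

text \<open>Witnessed by the partition into singletons. This bound later absorbs all additive
  errors.\<close>

lemma one_le_coarse: "1 \<le> coarse"
proof (rule coarse_ge)
  show "convex_partition S ((\<lambda>x. {x}) ` S)"
    by (auto simp: convex_partition_def partition_on_def island_def pairwise_def disjoint_def
        intro!: exI[of _ "{_}"])
  show "1 \<le> disc R B Y" if "Y \<in> (\<lambda>x. {x}) ` S" for Y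
    using that disjoint by (auto simp: disc_def Int_insert_left disjoint_iff)
qed

text \<open>Otherwise the traces of the cells on \<open>S\<close> would form a convex partition of
  discrepancy above the coarseness; none of them is empty, as an empty trace has balance 0.\<close>

lemma exists_cell_le_coarse:
  assumes "finite \<C>" "\<And>A. A \<in> \<C> \<Longrightarrow> convex A" "pairwise disjnt \<C>" "S \<subseteq> \<Union>\<C>"
  shows "\<exists>A\<in>\<C>. \<bar>bal A\<bar> \<le> coarse"
proof (rule ccontr)
  assume "\<not> ?thesis"
  then have big: "coarse < disc R B A" if "A \<in> \<C>" for A
    using that by (force simp: disc_eq_abs_balance)
  let ?P = "(\<lambda>A. A \<inter> S) ` \<C>"
  have disc: "disc R B (A \<inter> S) = disc R B A" for A
    by (simp only: disc_eq_abs_balance balance_Int_Un)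
  have ne: "A \<inter> S \<noteq> {}" if "A \<in> \<C>" for A
  proof
    assume "A \<inter> S = {}"
    then have "disc R B A = 0" using disc[of A] by (simp add: disc_eq_abs_balance)
    then show False using big[OF that] one_le_coarse by simp
  qed
  have "convex hull (A \<inter> S) \<inter> convex hull (A' \<inter> S) = {}" if "A \<in> \<C>" "A' \<in> \<C>" "A \<noteq> A'" for A A'
  proof -
    have "convex hull (A \<inter> S) \<subseteq> A" "convex hull (A' \<inter> S) \<subseteq> A'"
      using hull_minimal[of "A \<inter> S" A convex] hull_minimal[of "A' \<inter> S" A' convex] assms(2) that
      by auto
    then show ?thesis using assms(3) that unfolding pairwise_def disjnt_def by blast
  qed
  moreover have "{} \<notin> ?P" using ne by fastforce
  then have "partition_on S ?P"
    using assms(3,4) by (auto simp: partition_on_def disjoint_def pairwise_def disjnt_def)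
  moreover have "island S (A \<inter> S)" if "A \<in> \<C>" for A
    using assms(2) that by (auto simp: island_def)
  ultimately have "convex_partition S ?P"
    unfolding convex_partition_def pairwise_def by blast
  then have "coarse + 1 \<le> coarse"
    by (rule coarse_ge) (use big disc in force)
  then show False by simp
qed

section \<open>Cuts of large balance force large coarseness\<close>

lemma abs_balance_all: "\<bar>bal S\<bar> \<le> coarse"
proof -
  have "\<exists>A\<in>{UNIV}. \<bar>bal A\<bar> \<le> coarse" by (intro exists_cell_le_coarse) auto
  moreover have "bal UNIV = bal S" by (simp add: balance_def Int_absorb1)
  ultimately show ?thesis by simp
qed

text \<open>One of the two sides has absolute balance at most \<open>coarse\<close>; the other
  differs from it in absolute value by at most that of the whole set.\<close>

lemma abs_balance_halfplane_cut:
  assumes "hcut H"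
  shows "\<bar>bal H\<bar> \<le> 2 * coarse"
proof -
  obtain a b where H: "\<forall>x\<in>S. a \<bullet> x \<noteq> b" "H = {x\<in>S. a \<bullet> x > b}"
    using assms by (auto simp: halfplane_cut_def)
  let ?P = "{x. a \<bullet> x > b}" and ?Q = "{x. a \<bullet> x < b}"
  have "\<exists>A\<in>{?P, ?Q}. \<bar>bal A\<bar> \<le> coarse"
    using H by (intro exists_cell_le_coarse)
      (auto simp: convex_halfspace_gt convex_halfspace_lt pairwise_def disjnt_def linorder_neq_iff)
  moreover have "?P \<inter> S = H" "?Q \<inter> S = S - H" using H by (auto simp: linorder_neq_iff)
  then have "bal ?P = bal H" "bal ?Q = bal (S - H)"
    using balance_Int_Un[of R B ?P] balance_Int_Un[of R B ?Q] by simp_all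
  moreover have "bal S = bal H + bal (S - H)"
    using balance_split[of S H] halfplane_cut_subset[OF assms] by (simp add: Int_absorb1)
  ultimately show ?thesis using abs_balance_all by auto
qed

text \<open>General position enters the argument here.\<close>

lemma card_line_le_2:
  assumes "a \<noteq> (0 :: real^2)"
  shows "card {x\<in>S. a \<bullet> x = b} \<le> 2"
proof (rule ccontr)
  assume "\<not> ?thesis"
  then have "3 \<le> card {x\<in>S. a \<bullet> x = b}" by linarith
  then obtain X where "X \<subseteq> {x\<in>S. a \<bullet> x = b}" "card X = 3"
    by (rule obtain_subset_with_card_n)
  then obtain p q r where pqr: "{p, q, r} \<subseteq> {x\<in>S. a \<bullet> x = b}" "p \<noteq> q" "q \<noteq> r" "p \<noteq> r"
    unfolding card_3_iff by auto
  have "collinear {x. a \<bullet> x = b}"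
    using aff_dim_hyperplane[OF assms, of b] by (simp add: collinear_aff_dim)
  then have "collinear {p, q, r}" using pqr(1) collinear_subset by blast
  then show False using general pqr by (auto simp: general_position_def)
qed

text \<open>A discrete intermediate value argument: while the sublevel sets grow from empty to
  \<open>V\<close>, the property first fails at some value \<open>t\<close>, and only the fibre over
  \<open>t\<close> is added there.\<close>

lemma level_jump:
  fixes f :: "'c \<Rightarrow> real"
  assumes "finite V" "P {}" "\<not> P V"
  obtains t where "t \<in> f ` V" "P {x\<in>V. f x < t}" "\<not> P {x\<in>V. f x \<le> t}"
proof -
  let ?T = "{t \<in> f ` V. \<not> P {x\<in>V. f x \<le> t}}"
  have "V \<noteq> {}" using assms by auto
  then have "{x\<in>V. f x \<le> Max (f ` V)} = V" "Max (f ` V) \<in> f ` V" using assms(1) by auto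
  then have "Max (f ` V) \<in> ?T" using assms(3) by simp
  then have ne: "?T \<noteq> {}" "finite ?T" using assms(1) by auto
  define t where "t = Min ?T"
  have t: "t \<in> ?T" using ne unfolding t_def by (intro Min_in) auto
  have least: "t \<le> u" if "u \<in> ?T" for u using ne that unfolding t_def by (intro Min_le) auto
  have "P {x\<in>V. f x < t}"
  proof (cases "{x\<in>V. f x < t} = {}")
    case True
    then show ?thesis using assms(2) by (simp only:)
  next
    case False
    let ?W = "f ` {x\<in>V. f x < t}"
    define u where "u = Max ?W"
    have fin: "finite ?W" using assms(1) by simp
    have u: "u \<in> ?W" using False fin unfolding u_def by (intro Max_in) auto
    have "f x \<le> u" if "x \<in> V" "f x < t" for x
      using fin that unfolding u_def by (intro Max_ge) auto
    then have "{x\<in>V. f x < t} = {x\<in>V. f x \<le> u}" using u by auto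
    moreover have "P {x\<in>V. f x \<le> u}"
    proof (rule ccontr)
      assume "\<not> P {x\<in>V. f x \<le> u}"
      then have "u \<in> ?T" using u by blast
      then show False using least[of u] u by auto
    qed
    ultimately show ?thesis by (simp only:)
  qed
  then show thesis using that t by blast
qed

text \<open>Rotate a line through the apex of the wedge within the opposite wedge. Together with the sides
  of the wedge it yields a convex partition into three islands; the rest of the wedge's balance moves
  from one of the two outer islands to the other by steps of at most 2, so at some moment both
  outer islands have large balance.\<close>

lemma abs_balance_wedge_cut:
  assumes "hcut H1" "hcut H2"
  shows "\<bar>bal (H1 \<inter> H2)\<bar> \<le> 6 * coarse"
proof (rule ccontr)
  assume "\<not> ?thesis"
  then have big: "6 * coarse < \<bar>bal (H1 \<inter> H2)\<bar>" by simp
  obtain a1 b1 where 1: "\<forall>x\<in>S. a1 \<bullet> x \<noteq> b1" "H1 = {x\<in>S. a1 \<bullet> x > b1}"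
    using assms by (auto simp: halfplane_cut_def)
  obtain a2 b2 where 2: "\<forall>x\<in>S. a2 \<bullet> x \<noteq> b2" "H2 = {x\<in>S. a2 \<bullet> x > b2}"
    using assms by (auto simp: halfplane_cut_def)
  define f1 where "f1 x = a1 \<bullet> x - b1" for x
  define f2 where "f2 x = a2 \<bullet> x - b2" for x
  have H1: "H1 = {x\<in>S. f1 x > 0}" and H2: "H2 = {x\<in>S. f2 x > 0}"
    using 1 2 by (auto simp: f1_def f2_def)
  have nz: "f1 x \<noteq> 0" "f2 x \<noteq> 0" if "x \<in> S" for x using 1 2 that by (auto simp: f1_def f2_def)
  define V where "V = {x\<in>S. f1 x < 0 \<and> f2 x < 0}"
  define side where "side U = (H1 - H2) \<union> U" for U
  \<comment> \<open>Level sets of \<open>ratio\<close> lie on the lines \<open>f1 = t * f2\<close>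
    of the pencil spanned by the two sides, so \<open>t\<close> parametrizes the rotation within
    \<open>V\<close>, the opposite wedge.\<close>
  define ratio where "ratio x = f1 x / f2 x" for x
  have finV: "finite V" using finite_S by (simp add: V_def)
  have halves: "\<bar>bal H1\<bar> \<le> 2 * coarse" "\<bar>bal (S - H2)\<bar> \<le> 2 * coarse"
    using assms abs_balance_halfplane_cut halfplane_cut_Diff by blast+
  \<comment> \<open>At the start \<open>side {}\<close> is \<open>H1 - H2\<close>, of absolute
    balance above \<open>6 * coarse - 2 * coarse\<close>; at the end it is the cut
    \<open>S - H2\<close>, at most \<open>2 * coarse\<close>. So the threshold is crossed
    downwards.\<close>
  have "bal H1 = bal (H1 \<inter> H2) + bal (side {})"
    using balance_split[of H1 H2] by (simp add: side_def)
  then have "2 * coarse < \<bar>bal (side {})\<bar>" using big halves one_le_coarse by linarith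
  moreover have "side V = S - H2"
    using nz by (auto simp: side_def V_def H1 H2 linorder_neq_iff not_less)
  then have "\<not> 2 * coarse < \<bar>bal (side V)\<bar>" using halves by simp
  ultimately obtain t where t: "t \<in> ratio ` V" "2 * coarse < \<bar>bal (side {x\<in>V. ratio x < t})\<bar>"
    "\<not> 2 * coarse < \<bar>bal (side {x\<in>V. ratio x \<le> t})\<bar>"
    using level_jump[of V "\<lambda>U. 2 * coarse < \<bar>bal (side U)\<bar>" ratio] finV by blast
  have "t > 0" using t(1) by (auto simp: ratio_def V_def divide_neg_neg)
  define g where "g x = f1 x - t * f2 x" for x
  have g_eq: "g x = (a1 - t *\<^sub>R a2) \<bullet> x - (b1 - t * b2)" for x
    by (simp add: g_def f1_def f2_def inner_diff_left algebra_simps)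
  have V_ratio: "ratio x < t \<longleftrightarrow> g x > 0" "ratio x = t \<longleftrightarrow> g x = 0" if "x \<in> V" for x
    using that by (auto simp: V_def ratio_def g_def field_simps)
  have card: "card {x\<in>V. ratio x = t} \<le> 2"
  proof (cases "a1 - t *\<^sub>R a2 = 0")
    case False
    have "card {x\<in>V. ratio x = t} \<le> card {x\<in>S. (a1 - t *\<^sub>R a2) \<bullet> x = b1 - t * b2}"
      using V_ratio(2) finite_S by (intro card_mono) (auto simp: g_eq V_def)
    then show ?thesis using card_line_le_2[OF False, of "b1 - t * b2"] by simp
  next
    \<comment> \<open>The rotating line can degenerate only if \<open>f1\<close> is a positive
      multiple of \<open>f2\<close>; then the wedge is a halfplane cut and too small.\<close>
    case True
    obtain y where "y \<in> V" "ratio y = t" using t(1) by auto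
    then have "g y = 0" using V_ratio by simp
    then have "g x = 0" for x using True by (simp add: g_eq)
    then have "f1 x = t * f2 x" for x by (simp add: g_def)
    then have "H1 = H2" using \<open>t > 0\<close> by (auto simp: H1 H2 zero_less_mult_iff)
    then show ?thesis using big halves one_le_coarse by simp
  qed
  let ?P = "side {x\<in>V. ratio x < t}"
  let ?Q = "S - H1 \<inter> H2 - ?P"
  have "side {x\<in>V. ratio x \<le> t} = ?P \<union> {x\<in>V. ratio x = t}"
    by (auto simp: side_def)
  moreover have "?P \<inter> {x\<in>V. ratio x = t} = {}"
    by (auto simp: side_def V_def H1)
  ultimately have "bal (side {x\<in>V. ratio x \<le> t}) = bal ?P + bal {x\<in>V. ratio x = t}"
    using balance_Un[of ?P "{x\<in>V. ratio x = t}"] by simp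
  moreover have "\<bar>bal {x\<in>V. ratio x = t}\<bar> \<le> 2"
    using abs_balance_le_card[of "{x\<in>V. ratio x = t}" R B] card finV by simp
  ultimately have P: "\<bar>bal ?P\<bar> \<le> 2 * coarse + 2" using t(3) by linarith
  let ?cW = "{x. f1 x > 0} \<inter> {x. f2 x > 0}"
  let ?cP = "{x. f2 x < 0} \<inter> {x. g x > 0}"
  \<comment> \<open>The weak inequality gives this cell the points on the rotating line, matching
    the strict \<open>ratio x < t\<close> in \<open>?P\<close>.\<close>
  let ?cQ = "{x. f1 x < 0} \<inter> {x. g x \<le> 0}"
  have conv: "convex {x. f1 x > 0}" "convex {x. f2 x > 0}" "convex {x. f1 x < 0}" "convex {x. f2 x < 0}"
    "convex {x. g x > 0}" "convex {x. g x \<le> 0}"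
    using convex_halfspace_gt[of b1 a1] convex_halfspace_gt[of b2 a2] convex_halfspace_lt[of a1 b1]
      convex_halfspace_lt[of a2 b2] convex_halfspace_gt[of "b1 - t * b2" "a1 - t *\<^sub>R a2"]
      convex_halfspace_le[of "a1 - t *\<^sub>R a2" "b1 - t * b2"]
    by (simp_all add: f1_def f2_def g_eq)
  have g_outside: "f1 x > 0 \<Longrightarrow> f2 x < 0 \<Longrightarrow> g x > 0" "f1 x < 0 \<Longrightarrow> f2 x > 0 \<Longrightarrow> g x < 0" for x
    using mult_pos_neg[OF \<open>t > 0\<close>, of "f2 x"] mult_pos_pos[OF \<open>t > 0\<close>, of "f2 x"] by (auto simp: g_def)
  have "\<exists>A\<in>{?cW, ?cP, ?cQ}. \<bar>bal A\<bar> \<le> coarse"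
  proof (rule exists_cell_le_coarse)
    show "S \<subseteq> \<Union>{?cW, ?cP, ?cQ}"
    proof
      fix x assume "x \<in> S"
      then show "x \<in> \<Union>{?cW, ?cP, ?cQ}"
        using nz[of x] g_outside[of x] by (cases "f1 x > 0"; cases "f2 x > 0"; cases "g x > 0") auto
    qed
  qed (use conv in \<open>auto simp: convex_Int pairwise_def disjnt_def\<close>)
  moreover have "?cW \<inter> S = H1 \<inter> H2" by (auto simp: H1 H2)
  moreover have cP: "?cP \<inter> S = ?P"
  proof -
    have "x \<in> ?cP \<longleftrightarrow> x \<in> ?P" if "x \<in> S" for x
      using that nz[OF that] g_outside[of x] V_ratio(1)[of x]
      by (cases "f1 x > 0"; cases "f2 x > 0") (auto simp: side_def H1 H2 V_def)
    then show ?thesis by (auto simp: side_def H1 V_def)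
  qed
  moreover have "?cQ \<inter> S = ?Q"
  proof -
    have "x \<in> ?cQ \<longleftrightarrow> \<not> (f1 x > 0 \<and> f2 x > 0) \<and> x \<notin> ?cP" if "x \<in> S" for x
      using nz[OF that] g_outside[of x] by (cases "f1 x > 0"; cases "f2 x > 0"; cases "g x > 0") auto
    then show ?thesis unfolding cP[symmetric] H1 H2 by blast
  qed
  ultimately have "\<bar>bal (H1 \<inter> H2)\<bar> \<le> coarse \<or> \<bar>bal ?P\<bar> \<le> coarse \<or> \<bar>bal ?Q\<bar> \<le> coarse"
    using balance_Int_Un by (metis (no_types, lifting) insert_iff empty_iff)
  then have Q: "\<bar>bal ?Q\<bar> \<le> coarse" using big t(2) one_le_coarse by auto
  \<comment> \<open>The origin of the factor 6: the wedge has absolute balance at most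
    \<open>coarse\<close> for \<open>S\<close>, plus \<open>2 * coarse + 2\<close> for
    \<open>?P\<close>, plus \<open>coarse\<close> for \<open>?Q\<close>, and 2 is at most
    \<open>2 * coarse\<close>.\<close>
  have "bal S = bal (H1 \<inter> H2) + bal (S - H1 \<inter> H2)"
    using balance_split[of S "H1 \<inter> H2"] by (simp add: H1 Int_absorb1 subset_iff)
  moreover have "bal (S - H1 \<inter> H2) = bal ?P + bal ?Q"
  proof -
    have "(S - H1 \<inter> H2) \<inter> ?P = ?P" by (auto simp: side_def H1 V_def)
    then show ?thesis using balance_split[of "S - H1 \<inter> H2" ?P] by (simp only:)
  qed
  ultimately show False using abs_balance_all big P Q one_le_coarse by linarith
qed

lemma coarse_le_wedge_cuts:
  assumes bound: "\<And>E E'. hcut E \<Longrightarrow> hcut E' \<Longrightarrow> \<bar>bal (E \<inter> E')\<bar> \<le> m"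
  shows "coarse \<le> 3 ^ 8 * m"
proof -
  obtain P where P: "convex_partition S P" "\<And>Y. Y \<in> P \<Longrightarrow> coarse \<le> disc R B Y"
    using coarse_attained by blast
  have part: "\<Union>P = S" "{} \<notin> P" and dj: "pairwise (\<lambda>I J. convex hull I \<inter> convex hull J = {}) P"
    using P(1) by (auto simp: convex_partition_def partition_on_def)
  have finP: "finite P" "P \<noteq> {}" using convex_partition_finite_nonempty[OF P(1) finite_S nonempty] by auto
  have finI: "finite I" if "I \<in> P" for I
    using Union_upper[OF that] finite_S unfolding part(1) by (rule finite_subset)
  interpret disjoint_convex_family "(hull) convex ` P"
  proof
    show "pairwise disjnt ((hull) convex ` P)"
      by (rule pairwise_imageI) (use dj in \<open>simp add: pairwise_def disjnt_def\<close>)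
  qed (use finP part finI in \<open>auto simp: finite_imp_compact_convex_hull\<close>)
  obtain A N where A: "A \<in> (hull) convex ` P" and N: "finite N" "card N \<le> 8"
    "\<And>p a b. p \<in> A \<Longrightarrow> (a, b) \<in> N \<Longrightarrow> a \<bullet> p \<ge> b"
    "\<And>p D. D \<in> (hull) convex ` P \<Longrightarrow> D \<noteq> A \<Longrightarrow> p \<in> D \<Longrightarrow> \<exists>(a, b)\<in>N. a \<bullet> p < b"
  proof (rule exists_polygonal_separation)
    show "(hull) convex ` P \<noteq> {}" using finP by simp
  qed (rule that)
  from A obtain I where I: "I \<in> P" "A = convex hull I" by auto
  let ?h = "\<lambda>(a, b). {x\<in>S. a \<bullet> x \<ge> b}"
  obtain Ns where Ns: "set Ns = N" "length Ns = card N" using N(1) by (metis finite_distinct_list distinct_card)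
  have "S \<inter> \<Inter>(set (map ?h Ns)) = I"
  proof (intro equalityI subsetI)
    fix x assume x: "x \<in> I"
    then have "x \<in> A" "x \<in> S" using I part hull_inc by auto
    then show "x \<in> S \<inter> \<Inter>(set (map ?h Ns))" using N(3) Ns by auto
  next
    fix x assume x: "x \<in> S \<inter> \<Inter>(set (map ?h Ns))"
    then obtain J where J: "J \<in> P" "x \<in> J" using part by blast
    show "x \<in> I"
    proof (rule ccontr)
      assume "x \<notin> I"
      then have "I \<noteq> J" using J by auto
      then have "convex hull I \<inter> convex hull J = {}" using dj I J by (auto simp: pairwise_def)
      moreover have "x \<in> convex hull J" using J(2) by (rule hull_inc)
      ultimately have "convex hull J \<noteq> A" using I by auto
      then obtain a b where "(a, b) \<in> N" "a \<bullet> x < b" 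
        using N(4)[of "convex hull J" x] J \<open>x \<in> convex hull J\<close> by auto
      then show False using x Ns by fastforce
    qed
  qed
  moreover have "\<forall>H\<in>set (map ?h Ns). hcut H"
    using halfplane_cut_ge[OF finite_S] by auto
  ultimately have "\<bar>bal I\<bar> \<le> 3 ^ length (map ?h Ns) * m"
    using balance_Int_cuts[where m = m and Hs = "map ?h Ns"] bound by (simp only:)
  also have "\<dots> \<le> 3 ^ 8 * m"
  proof (rule mult_right_mono)
    show "(3 :: int) ^ length (map ?h Ns) \<le> 3 ^ 8" using N(2) Ns by (intro power_increasing) auto
    show "0 \<le> m" using bound[OF halfplane_cut_self halfplane_cut_self] by linarith
  qed
  finally show ?thesis using P(2)[OF I(1)] by (simp add: disc_eq_abs_balance)
qed

section \<open>Wedges spanned by input points\<close>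

lemma orient_eq_inner: "orient p q x = vector [- (q$2 - p$2), q$1 - p$1] \<bullet> x - vector [- (q$2 - p$2), q$1 - p$1] \<bullet> p"
  by (simp add: orient_def inner_vec_def sum_2 algebra_simps)

lemma orient_eq_0_imp_in:
  assumes "p \<in> S" "q \<in> S" "p \<noteq> q" "x \<in> S" "orient p q x = 0"
  shows "x = p \<or> x = q"
proof (rule ccontr)
  assume ne: "\<not> ?thesis"
  let ?a = "vector [- (q$2 - p$2), q$1 - p$1] :: real^2"
  have "?a \<noteq> 0"
  proof
    assume "?a = 0"
    then have "?a$1 = 0" "?a$2 = 0" by (simp_all only: zero_index)
    then show False using assms(3) vec2_eqI[of p q] by simp
  qed
  moreover have "orient p q p = 0" "orient p q q = 0" by (simp_all add: orient_def)
  then have sub: "{p, q, x} \<subseteq> {y\<in>S. ?a \<bullet> y = ?a \<bullet> p}"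
    using assms by (auto simp: orient_eq_inner)
  have "card {p, q, x} \<le> card {y\<in>S. ?a \<bullet> y = ?a \<bullet> p}"
    using sub finite_S by (intro card_mono) auto
  ultimately show False using card_line_le_2[of ?a "?a \<bullet> p"] ne assms(3) by auto
qed

definition left :: "real^2 \<Rightarrow> real^2 \<Rightarrow> (real^2) set" where
  "left p q = {x\<in>S. 0 < orient p q x}"

lemma halfplane_cut_left: "hcut (left p q)"
  using halfplane_cut_greater[OF finite_S] by (simp add: left_def orient_eq_inner)

text \<open>The points \<open>p\<close> and \<open>q\<close> span an inner common tangent of \<open>H\<close> and its complement: in coordinates
  \<open>f\<close> across and \<open>u\<close> along the separating line, it is the pair of maximal slope.\<close>

lemma halfplane_cut_canonical:
  assumes "hcut H" "H \<noteq> {}" "H \<noteq> S"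
  obtains p q where "p \<in> S" "q \<in> S" "p \<noteq> q" "H = insert p (left p q)"
proof -
  obtain a b where H: "H = {x\<in>S. a \<bullet> x > b}"
    using assms by (auto simp: halfplane_cut_def)
  define f where "f x = a$1 * x$1 + a$2 * x$2" for x :: "real^2"
  define u where "u x = a$1 * x$2 - a$2 * x$1" for x :: "real^2"
  have f: "x \<in> H \<longleftrightarrow> x \<in> S \<and> f x > b" for x
    by (auto simp: H f_def inner_vec_def sum_2)
  let ?Z = "H \<times> (S - H)"
  define slope where "slope = (\<lambda>(p, q). (u p - u q) / (f p - f q))"
  have fin: "finite ?Z" using finite_S H by auto
  have "?Z \<noteq> {}" using assms H by auto
  then have "Max (slope ` ?Z) \<in> slope ` ?Z" using fin by (intro Max_in) auto
  then obtain p q where pq: "p \<in> H" "q \<in> S - H" "Max (slope ` ?Z) = slope (p, q)" by auto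
  have max: "slope (p', q') \<le> slope (p, q)" if "p' \<in> H" "q' \<in> S - H" for p' q'
    unfolding pq(3)[symmetric] using fin that by (intro Max_ge) auto
  have pos: "f p' - f q' > 0" if "p' \<in> H" "q' \<in> S - H" for p' q' using that f by force
  have "a \<noteq> 0"
    using pos[OF pq(1,2)] by (auto simp: f_def)
  then have aa: "a$1 * a$1 + a$2 * a$2 > 0"
    using vec2_eqI[of a 0] by (auto simp: sum_squares_gt_zero_iff)
  have key: "(u p' - u q') * (f p - f q) \<le> (u p - u q) * (f p' - f q')" if "p' \<in> H" "q' \<in> S - H" for p' q'
    using max[OF that] pos[OF that] pos[OF pq(1,2)] by (simp add: slope_def field_simps)
  \<comment> \<open>Maximality of the slope against the pairs \<open>(x, q)\<close> and
    \<open>(p, x)\<close> is, up to the positive factor \<open>a \<bullet> a\<close>, a statement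
    about the side of the line through \<open>p\<close> and \<open>q\<close> on which
    \<open>x\<close> lies.\<close>
  have up: "orient p q x \<ge> 0" if "x \<in> H" for x
  proof -
    have "(u p - u q) * (f x - f q) - (u x - u q) * (f p - f q) = (a$1 * a$1 + a$2 * a$2) * orient p q x"
      unfolding u_def f_def orient_def by algebra
    then have "0 \<le> (a$1 * a$1 + a$2 * a$2) * orient p q x" using key[OF that pq(2)] by simp
    then show ?thesis using aa by (simp add: zero_le_mult_iff)
  qed
  have down: "orient p q x \<le> 0" if "x \<in> S - H" for x
  proof -
    have "(u p - u q) * (f p - f x) - (u p - u x) * (f p - f q) = - ((a$1 * a$1 + a$2 * a$2) * orient p q x)"
      unfolding u_def f_def orient_def by algebra
    then have "(a$1 * a$1 + a$2 * a$2) * orient p q x \<le> 0" using key[OF pq(1) that] by simp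
    then show ?thesis using aa by (simp add: mult_le_0_iff)
  qed
  have ne: "p \<noteq> q" "p \<in> S" "q \<in> S" using pq f by auto
  \<comment> \<open>The line meets \<open>S\<close> only in \<open>p\<close>, which belongs to
    \<open>H\<close>, and \<open>q\<close>, which does not.\<close>
  have "H = insert p (left p q)"
  proof (intro equalityI subsetI)
    fix x assume x: "x \<in> H"
    then show "x \<in> insert p (left p q)"
      using up[OF x] orient_eq_0_imp_in[of p q x] ne pq f by (cases "orient p q x = 0") (auto simp: left_def)
  next
    fix x assume "x \<in> insert p (left p q)"
    then show "x \<in> H" using pq down[of x] by (force simp: left_def)
  qed
  then show thesis using that ne by blast
qed

lemma wedge_Int_S: "wedge p q r s \<inter> S = left p q \<inter> left r s"
  by (auto simp: wedge_def left_def)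

lemma balance_wedge: "bal (wedge p q r s) = bal (left p q \<inter> left r s)"
  using balance_Int_Un[of R B "wedge p q r s"] by (simp only: wedge_Int_S)

lemma disc_wedge_le: "disc R B (wedge p q r s) \<le> 6 * coarse"
  using abs_balance_wedge_cut[OF halfplane_cut_left halfplane_cut_left]
  by (simp add: disc_eq_abs_balance balance_wedge)

lemma abs_balance_approx:
  assumes "Y \<subseteq> X" "X \<subseteq> Y \<union> Z" "finite Z"
  shows "\<bar>bal X\<bar> \<le> \<bar>bal Y\<bar> + int (card Z)"
proof -
  have "card (X - Y) \<le> card Z" using assms by (intro card_mono) auto
  moreover have "\<bar>bal (X - Y)\<bar> \<le> int (card (X - Y))"
    using assms by (intro abs_balance_le_card finite_subset[of "X - Y" Z]) auto
  moreover have "X \<inter> Y = Y" using assms by auto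
  ultimately show ?thesis using balance_split[of X Y] by simp
qed

text \<open>Lost points are absorbed by \<open>1 \<le> m\<close>. The factor 4 is due to the whole
  set, which is two opposite open halfplanes and two points, hence \<open>2 * m + 2\<close>; single
  halfplanes and wedges lose at most 1 and 2 points.\<close>

lemma coarse_le_wedges:
  assumes m: "1 \<le> m" "\<And>p q r s. p \<in> S \<Longrightarrow> q \<in> S \<Longrightarrow> r \<in> S \<Longrightarrow> s \<in> S \<Longrightarrow> disc R B (wedge p q r s) \<le> m"
  shows "coarse \<le> 3 ^ 8 * (4 * m)"
proof (rule coarse_le_wedge_cuts)
  have lefts: "\<bar>bal (left p q \<inter> left r s)\<bar> \<le> m" if "p \<in> S" "q \<in> S" "r \<in> S" "s \<in> S" for p q r s
    using m(2)[OF that] by (simp add: disc_eq_abs_balance balance_wedge)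
  have whole: "\<bar>bal S\<bar> \<le> 4 * m"
  proof (cases "\<exists>p\<in>S. \<exists>q\<in>S. p \<noteq> q")
    case True
    then obtain p q where pq: "p \<in> S" "q \<in> S" "p \<noteq> q" by blast
    have rev: "orient q p x = - orient p q x" for x by (simp add: orient_def algebra_simps)
    have "S \<subseteq> (left p q \<union> left q p) \<union> {p, q}"
    proof
      fix x assume "x \<in> S"
      then show "x \<in> (left p q \<union> left q p) \<union> {p, q}"
        using orient_eq_0_imp_in[OF pq, of x]
        by (cases "orient p q x" "0 :: real" rule: linorder_cases) (auto simp: left_def rev)
    qed
    then have "\<bar>bal S\<bar> \<le> \<bar>bal (left p q \<union> left q p)\<bar> + 2"
      using abs_balance_approx[of "left p q \<union> left q p" S "{p, q}"] pq by (auto simp: left_def)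
    also have "bal (left p q \<union> left q p) = bal (left p q) + bal (left q p)"
      by (rule balance_Un) (auto simp: left_def rev)
    finally show ?thesis using lefts[of p q p q] lefts[of q p q p] pq m(1) by simp
  next
    case False
    then have "card S \<le> 1" using card_le_Suc0_iff_eq[OF finite_S] by auto
    then show ?thesis using abs_balance_le_card[OF finite_S, of R B] m(1) by linarith
  qed
  have half: "\<bar>bal H\<bar> \<le> 4 * m" if H: "hcut H" for H
  proof (cases "H = {} \<or> H = S")
    case True
    then show ?thesis using whole m(1) by auto
  next
    case False
    then obtain p q where "p \<in> S" "q \<in> S" "H = insert p (left p q)"
      using halfplane_cut_canonical H by metis
    then have "\<bar>bal H\<bar> \<le> \<bar>bal (left p q)\<bar> + 1"
      using abs_balance_approx[of "left p q" H "{p}"] by auto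
    then show ?thesis
      using lefts[of p q p q] \<open>p \<in> S\<close> \<open>q \<in> S\<close> m(1) by simp
  qed
  fix E E' assume E: "hcut E" "hcut E'"
  show "\<bar>bal (E \<inter> E')\<bar> \<le> 4 * m"
  proof (cases "E = {} \<or> E' = {} \<or> E = S \<or> E' = S")
    case True
    then have "E \<inter> E' \<in> {{}, E, E'}" using halfplane_cut_subset E by blast
    then show ?thesis using half E m(1) by auto
  next
    case False
    obtain p q where p: "p \<in> S" "q \<in> S" "E = insert p (left p q)"
      using halfplane_cut_canonical[OF E(1)] False by metis
    obtain r s where r: "r \<in> S" "s \<in> S" "E' = insert r (left r s)"
      using halfplane_cut_canonical[OF E(2)] False by metis
    have "\<bar>bal (E \<inter> E')\<bar> \<le> \<bar>bal (left p q \<inter> left r s)\<bar> + int (card {p, r})"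
      using p r by (intro abs_balance_approx) auto
    also have "card {p, r} \<le> 2" by (simp add: card_insert_if)
    finally show ?thesis using lefts[of p q r s] p r m(1) by linarith
  qed
qed

end

section \<open>The program\<close>

definition runs :: "com \<Rightarrow> state \<Rightarrow> nat \<Rightarrow> (state \<Rightarrow> bool) \<Rightarrow> bool" where
  "runs c s T Q \<longleftrightarrow> (\<exists>t s'. exec c s t s' \<and> t \<le> T \<and> Q s')"

lemma runs_mono:
  assumes "runs c s T Q" "T \<le> U" "\<And>s'. Q s' \<Longrightarrow> Q' s'"
  shows "runs c s U Q'"
  using assms unfolding runs_def by (meson order_trans)

lemma runs_Skip: "Q s \<Longrightarrow> 1 \<le> T \<Longrightarrow> runs Skip s T Q"
  unfolding runs_def by (meson exec.Skip)

lemma runs_NSet: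
  "Q (nset a (nval e s) (nval f s) s) \<Longrightarrow> 1 + ncost e + ncost f \<le> T \<Longrightarrow> runs (NSet a e f) s T Q"
  unfolding runs_def by (meson exec.NSet)

lemma runs_RSet:
  "Q (rset a (nval e s) (rval f s) s) \<Longrightarrow> 1 + ncost e + rcost f \<le> T \<Longrightarrow> runs (RSet a e f) s T Q"
  unfolding runs_def by (meson exec.RSet)

text \<open>The postcondition of the first command is the claim about the second, so no intermediate
  assertion has to be named.\<close>

lemma runs_Seq:
  assumes "runs c s T (\<lambda>s'. runs d s' U Q)" "T + U \<le> V"
  shows "runs (Seq c d) s V Q"
  using assms unfolding runs_def by (meson exec.Seq add_mono order_trans)

lemma runs_Cond:
  assumes "bval b s \<Longrightarrow> runs c s T Q" "\<not> bval b s \<Longrightarrow> runs d s T Q" "1 + bcost b + T \<le> U"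
  shows "runs (Cond b c d) s U Q"
proof (cases "bval b s")
  case True
  then obtain t s' where "exec c s t s'" "t \<le> T" "Q s'"
    using assms(1) unfolding runs_def by blast
  then show ?thesis
    using exec.CondTrue[OF True] assms(3) unfolding runs_def
    by (meson add_left_mono order_trans)
next
  case False
  then obtain t s' where "exec d s t s'" "t \<le> T" "Q s'"
    using assms(2) unfolding runs_def by blast
  then show ?thesis
    using exec.CondFalse[OF False] assms(3) unfolding runs_def
    by (meson add_left_mono order_trans)
qed

abbreviation nvar :: "name \<Rightarrow> nexp" where
  "nvar a \<equiv> NGet a (NConst 0)"

definition incr :: "name \<Rightarrow> com" where
  "incr a = NSet a (NConst 0) (NAdd (nvar a) (NConst 1))"

definition for_below_n :: "name \<Rightarrow> com \<Rightarrow> com" where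
  "for_below_n v c = Seq (NSet v (NConst 0) (NConst 0))
     (While (NLess (nvar v) (nvar ''n'')) (Seq c (incr v)))"

text \<open>Besides its body, a round costs 6 for the test and 6 for the increment; the 9 is 3 for
  initialization and 6 for the last, failing test.\<close>

lemma runs_for_below_n:
  assumes init: "I 0 (nset v 0 0 s)"
    and counter: "\<And>i s. I i s \<Longrightarrow> nats s v 0 = i \<and> nats s ''n'' 0 = n"
    and step: "\<And>i s. i < n \<Longrightarrow> I i s \<Longrightarrow>
      runs c s T (\<lambda>s'. nats s' v 0 = i \<and> I (Suc i) (nset v 0 (Suc i) s'))"
    and bound: "9 + n * (T + 12) \<le> U"
  shows "runs (for_below_n v c) s U (I n)"
proof -
  let ?w = "While (NLess (nvar v) (nvar ''n'')) (Seq c (incr v))"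
  have loop: "runs ?w s (6 + k * (T + 12)) (I n)" if "I i s" "i \<le> n" "n - i = k" for k i s
    using that
  proof (induction k arbitrary: i s)
    case 0
    then have "i = n" by simp
    moreover have "exec ?w s 6 s"
      using exec.WhileFalse[of "NLess (nvar v) (nvar ''n'')" s "Seq c (incr v)"] counter[OF 0(1)] \<open>i = n\<close>
      by (simp add: eval_nat_numeral)
    ultimately show ?case
      using 0(1) unfolding runs_def by auto
  next
    case (Suc k)
    then have "i < n" by simp
    then obtain t s' where t: "exec c s t s'" "t \<le> T" "nats s' v 0 = i"
      and I: "I (Suc i) (nset v 0 (Suc i) s')"
      using step[OF _ Suc.prems(1)] unfolding runs_def by blast
    have "exec (incr v) s' 6 (nset v 0 (Suc i) s')"
      using exec.NSet[of v "NConst 0" "NAdd (nvar v) (NConst 1)" s'] t(3)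
      by (simp add: incr_def eval_nat_numeral)
    with t(1) have body: "exec (Seq c (incr v)) s (t + 6) (nset v 0 (Suc i) s')"
      by (rule exec.Seq)
    have "runs ?w (nset v 0 (Suc i) s') (6 + k * (T + 12)) (I n)"
      using Suc.prems by (intro Suc.IH[OF I]) auto
    then obtain u s'' where u: "exec ?w (nset v 0 (Suc i) s') u s''" "u \<le> 6 + k * (T + 12)" "I n s''"
      unfolding runs_def by blast
    have "bval (NLess (nvar v) (nvar ''n'')) s"
      using counter[OF Suc.prems(1)] \<open>i < n\<close> by simp
    from exec.WhileTrue[OF this body u(1)] show ?case
      using u t(2) unfolding runs_def by fastforce
  qed
  have "runs ?w (nset v 0 0 s) (6 + n * (T + 12)) (I n)"
    using init by (rule loop) auto
  then show ?thesis
    unfolding for_below_n_def using bound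
    by (intro runs_Seq[where T = 3 and U = "6 + n * (T + 12)"] runs_NSet) auto
qed

text \<open>A frame condition: \<open>X\<close> collects the arrays of naturals that may be written.
  Real arrays stay fixed until the final output.\<close>

definition agree :: "name set \<Rightarrow> state \<Rightarrow> state \<Rightarrow> bool" where
  "agree X s s' \<longleftrightarrow> reals s' = reals s \<and> (\<forall>a. a \<notin> X \<longrightarrow> nats s' a = nats s a)"

lemma agree_refl [simp]: "agree X s s"
  by (simp add: agree_def)

lemma agree_trans: "agree X s s' \<Longrightarrow> agree Y s' s'' \<Longrightarrow> X \<subseteq> Z \<Longrightarrow> Y \<subseteq> Z \<Longrightarrow> agree Z s s''"
  unfolding agree_def by (metis subsetD)

lemma agree_nset: "agree X s s' \<Longrightarrow> a \<in> X \<Longrightarrow> agree X s (nset a i v s')"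
  by (auto simp: agree_def nset_def)

lemma nats_nset [simp]: "nats (nset a i v s) = (nats s)(a := (nats s a)(i := v))"
  by (simp add: nset_def)

lemma reals_nset [simp]: "reals (nset a i v s) = reals s"
  by (simp add: nset_def)

section \<open>The program text\<close>

definition orient_exp :: "name \<Rightarrow> name \<Rightarrow> name \<Rightarrow> rexp" where
  "orient_exp a b c =
     (let p = nvar a; q = nvar b; x = nvar c in
      RSub (RMul (RSub (RGet ''x'' q) (RGet ''x'' p)) (RSub (RGet ''y'' x) (RGet ''y'' p)))
           (RMul (RSub (RGet ''y'' q) (RGet ''y'' p)) (RSub (RGet ''x'' x) (RGet ''x'' p))))"

definition inside :: bexp where
  "inside = BAnd (RLess (RNat (NConst 0)) (orient_exp ''i'' ''j'' ''m''))
                 (RLess (RNat (NConst 0)) (orient_exp ''k'' ''l'' ''m''))"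

definition count_point :: com where
  "count_point = Cond inside
     (Cond (NLess (NConst 0) (NGet ''color'' (nvar ''m''))) (incr ''red'') (incr ''blue'')) Skip"

definition count_wedge :: com where
  "count_wedge = Seq (NSet ''red'' (NConst 0) (NConst 0)) (Seq (NSet ''blue'' (NConst 0) (NConst 0))
     (for_below_n ''m'' count_point))"

text \<open>Truncated subtraction gives the positive part of the difference; calling this in both
  orders accounts for the absolute value.\<close>

definition raise_best :: "name \<Rightarrow> name \<Rightarrow> com" where
  "raise_best a b = Cond (NLess (nvar ''best'') (NSub (nvar a) (nvar b)))
     (NSet ''best'' (NConst 0) (NSub (nvar a) (nvar b))) Skip"

definition try_wedge :: com where
  "try_wedge = Seq count_wedge (Seq (raise_best ''red'' ''blue'') (raise_best ''blue'' ''red''))"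

text \<open>The start value 1 is safe since the coarseness is at least 1, and it supplies
  \<open>1 \<le> m\<close> in \<open>coarse_le_wedges\<close>. Division by 6 turns
  \<open>disc_wedge_le\<close> into the bound of the output by the coarseness.\<close>

definition best_wedge :: com where
  "best_wedge = Seq (NSet ''best'' (NConst 0) (NConst 1))
     (Seq (for_below_n ''i'' (for_below_n ''j'' (for_below_n ''k'' (for_below_n ''l'' try_wedge))))
          (RSet ''out'' (NConst 0) (RDiv (RNat (nvar ''best'')) (RNat (NConst 6)))))"

abbreviation scratch :: "name set" where
  "scratch \<equiv> {''i'', ''j'', ''k'', ''l'', ''m'', ''red'', ''blue'', ''best''}"

section \<open>Correctness and running time of the program\<close>

context
  fixes ps :: "(real^2) list" and R B :: "(real^2) set"
  assumes ps: "distinct ps" "set ps = R \<union> B" and disjoint: "R \<inter> B = {}"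
begin

abbreviation wedge_disc :: "nat \<Rightarrow> nat \<Rightarrow> nat \<Rightarrow> nat \<Rightarrow> nat" where
  "wedge_disc i j k l \<equiv> nat (disc R B (wedge (ps ! i) (ps ! j) (ps ! k) (ps ! l)))"

definition ready :: "state \<Rightarrow> bool" where
  "ready s \<longleftrightarrow> agree scratch (input ps R) s"

lemma ready_nset: "ready s \<Longrightarrow> a \<in> scratch \<Longrightarrow> ready (nset a i v s)"
  unfolding ready_def by (rule agree_nset)

lemma ready_agree: "ready s \<Longrightarrow> agree X s s' \<Longrightarrow> X \<subseteq> scratch \<Longrightarrow> ready s'"
  unfolding ready_def by (erule agree_trans) auto

lemma ready_n: "ready s \<Longrightarrow> nats s ''n'' 0 = length ps"
  by (simp add: ready_def agree_def input_def)

lemma ready_color: "ready s \<Longrightarrow> nats s ''color'' i = (if i < length ps \<and> ps ! i \<in> R then 1 else 0)"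
  by (simp add: ready_def agree_def input_def)

lemma ready_coord:
  "ready s \<Longrightarrow> i < length ps \<Longrightarrow> reals s ''x'' i = (ps ! i) $ 1"
  "ready s \<Longrightarrow> i < length ps \<Longrightarrow> reals s ''y'' i = (ps ! i) $ 2"
  by (simp_all add: ready_def agree_def input_def)

lemma rval_orient_exp:
  assumes "ready s" "nats s a 0 < length ps" "nats s b 0 < length ps" "nats s c 0 < length ps"
  shows "rval (orient_exp a b c) s = orient (ps ! nats s a 0) (ps ! nats s b 0) (ps ! nats s c 0)"
  using assms by (simp add: orient_exp_def Let_def orient_def ready_coord)

text \<open>Distinctness of the list turns numbers of indices into numbers of points.\<close>

lemma card_indices: "card {t. t < length ps \<and> ps ! t \<in> X} = card (X \<inter> set ps)"
proof (rule bij_betw_same_card)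
  show "bij_betw ((!) ps) {t. t < length ps \<and> ps ! t \<in> X} (X \<inter> set ps)"
    using ps(1) by (auto simp: bij_betw_def inj_on_def nth_eq_iff_index_eq in_set_conv_nth)
qed

lemma card_less_Suc_conj:
  "card {t. t < Suc m \<and> P t} = card {t. t < m \<and> P t} + (if P m then 1 else 0)"
proof -
  have "{t. t < Suc m \<and> P t} = (if P m then insert m {t. t < m \<and> P t} else {t. t < m \<and> P t})"
    by (auto simp: less_Suc_eq)
  then show ?thesis by simp
qed

lemma runs_count_point:
  assumes s: "ready s" "nats s ''i'' 0 < length ps" "nats s ''j'' 0 < length ps"
      "nats s ''k'' 0 < length ps" "nats s ''l'' 0 < length ps" "nats s ''m'' 0 < length ps"
    and W: "W = wedge (ps ! nats s ''i'' 0) (ps ! nats s ''j'' 0) (ps ! nats s ''k'' 0) (ps ! nats s ''l'' 0)"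
    and x: "x = ps ! nats s ''m'' 0"
  shows "runs count_point s 200 (\<lambda>s'. agree {''red'', ''blue''} s s' \<and>
     nats s' ''red'' 0 = nats s ''red'' 0 + (if x \<in> W \<inter> R then 1 else 0) \<and>
     nats s' ''blue'' 0 = nats s ''blue'' 0 + (if x \<in> W \<inter> B then 1 else 0))"
proof -
  \<comment> \<open>Every listed point has exactly one color, so a point not marked red is
    blue.\<close>
  have "x \<in> R \<longleftrightarrow> x \<notin> B" using s(6) ps(2) disjoint x nth_mem by blast
  moreover have "bval inside s \<longleftrightarrow> x \<in> W"
    using s by (simp add: inside_def rval_orient_exp W x wedge_def)
  moreover have "bcost inside \<le> 150"
    by (simp add: inside_def orient_exp_def Let_def)
  ultimately show ?thesis
    unfolding count_point_def incr_def using s(1,6) x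
    by (intro runs_Cond[where T = 20] runs_Cond[where T = 10] runs_NSet runs_Skip)
      (auto simp: ready_color agree_nset)
qed

lemma runs_count_wedge:
  assumes s: "ready s" "nats s ''i'' 0 < length ps" "nats s ''j'' 0 < length ps"
      "nats s ''k'' 0 < length ps" "nats s ''l'' 0 < length ps"
    and W: "W = wedge (ps ! nats s ''i'' 0) (ps ! nats s ''j'' 0) (ps ! nats s ''k'' 0) (ps ! nats s ''l'' 0)"
  shows "runs count_wedge s (100 + length ps * 300) (\<lambda>s'. agree {''red'', ''blue'', ''m''} s s' \<and>
     nats s' ''red'' 0 = card (W \<inter> R) \<and> nats s' ''blue'' 0 = card (W \<inter> B))"
proof -
  let ?s0 = "nset ''blue'' 0 0 (nset ''red'' 0 0 s)"
  let ?I = "\<lambda>m s'. agree {''red'', ''blue'', ''m''} s s' \<and> nats s' ''m'' 0 = m \<and>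
     nats s' ''red'' 0 = card {t. t < m \<and> ps ! t \<in> W \<inter> R} \<and>
     nats s' ''blue'' 0 = card {t. t < m \<and> ps ! t \<in> W \<inter> B}"
  have "runs (for_below_n ''m'' count_point) ?s0 (10 + length ps * 300) (?I (length ps))"
  proof (rule runs_for_below_n[where T = 200 and I = ?I and n = "length ps"])
    show "?I 0 (nset ''m'' 0 0 ?s0)"
      by (auto intro!: agree_nset)
  next
    fix m s' assume I: "?I m s'"
    then have "ready s'"
      using ready_agree[OF s(1), of "{''red'', ''blue'', ''m''}"] by auto
    with I show "nats s' ''m'' 0 = m \<and> nats s' ''n'' 0 = length ps"
      by (simp add: ready_n)
  next
    fix m s' assume m: "m < length ps" and I: "?I m s'"
    then have "ready s'"
      using ready_agree[OF s(1), of "{''red'', ''blue'', ''m''}"] by auto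
    have same: "nats s' ''i'' = nats s ''i''" "nats s' ''j'' = nats s ''j''"
      "nats s' ''k'' = nats s ''k''" "nats s' ''l'' = nats s ''l''"
      using I by (auto simp: agree_def)
    show "runs count_point s' 200
      (\<lambda>s''. nats s'' ''m'' 0 = m \<and> ?I (Suc m) (nset ''m'' 0 (Suc m) s''))"
    proof (rule runs_mono[OF runs_count_point[OF \<open>ready s'\<close>, where W = W and x = "ps ! m"]])
      fix s'' assume *: "agree {''red'', ''blue''} s' s'' \<and>
        nats s'' ''red'' 0 = nats s' ''red'' 0 + (if ps ! m \<in> W \<inter> R then 1 else 0) \<and>
        nats s'' ''blue'' 0 = nats s' ''blue'' 0 + (if ps ! m \<in> W \<inter> B then 1 else 0)"
      then have "agree {''red'', ''blue'', ''m''} s s''"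
        using I by (auto intro: agree_trans)
      moreover have "nats s'' ''m'' = nats s' ''m''"
        using * by (auto simp: agree_def)
      ultimately show "nats s'' ''m'' 0 = m \<and> ?I (Suc m) (nset ''m'' 0 (Suc m) s'')"
        using * I by (auto simp: card_less_Suc_conj intro!: agree_nset)
    qed (use s I m W same in auto)
  qed simp
  moreover have "R \<inter> set ps = R" "B \<inter> set ps = B" using ps(2) by auto
  ultimately have "runs (for_below_n ''m'' count_point) ?s0 (10 + length ps * 300)
    (\<lambda>s'. agree {''red'', ''blue'', ''m''} s s' \<and>
     nats s' ''red'' 0 = card (W \<inter> R) \<and> nats s' ''blue'' 0 = card (W \<inter> B))"
    by (elim runs_mono) (simp_all add: card_indices Int_assoc del: Int_iff)
  then show ?thesis
    unfolding count_wedge_def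
    by (intro runs_Seq[where T = 3 and U = "20 + length ps * 300"] runs_NSet
        runs_Seq[where T = 3 and U = "10 + length ps * 300"]) auto
qed

lemma runs_raise_best:
  assumes "a \<noteq> ''best''" "b \<noteq> ''best''"
  shows "runs (raise_best a b) s 30 (\<lambda>s'. agree {''best''} s s' \<and>
     nats s' ''best'' 0 = max (nats s ''best'' 0) (nats s a 0 - nats s b 0))"
  unfolding raise_best_def using assms
  by (intro runs_Cond[where T = 15] runs_NSet runs_Skip) (auto simp: agree_nset)

lemma max_nat_diffs: "max (max a (x - y)) (y - x) = max a (nat \<bar>int x - int y\<bar>)"
  by arith

lemma runs_try_wedge:
  assumes s: "ready s" "nats s ''i'' 0 < length ps" "nats s ''j'' 0 < length ps"
      "nats s ''k'' 0 < length ps" "nats s ''l'' 0 < length ps"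
  shows "runs try_wedge s (200 + length ps * 300) (\<lambda>s'.
     agree {''red'', ''blue'', ''m'', ''best''} s s' \<and>
     nats s' ''best'' 0 = max (nats s ''best'' 0)
       (wedge_disc (nats s ''i'' 0) (nats s ''j'' 0) (nats s ''k'' 0) (nats s ''l'' 0)))"
proof -
  let ?W = "wedge (ps ! nats s ''i'' 0) (ps ! nats s ''j'' 0) (ps ! nats s ''k'' 0) (ps ! nats s ''l'' 0)"
  let ?Q = "\<lambda>s'. agree {''red'', ''blue'', ''m'', ''best''} s s' \<and>
     nats s' ''best'' 0 = max (nats s ''best'' 0) (nat (disc R B ?W))"
  have "runs (Seq (raise_best ''red'' ''blue'') (raise_best ''blue'' ''red'')) s1 60 ?Q"
    if s1: "agree {''red'', ''blue'', ''m''} s s1"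
       "nats s1 ''red'' 0 = card (?W \<inter> R)" "nats s1 ''blue'' 0 = card (?W \<inter> B)" for s1
  proof (rule runs_Seq[OF runs_mono[OF runs_raise_best order_refl]])
    fix s2 assume s2: "agree {''best''} s1 s2 \<and>
      nats s2 ''best'' 0 = max (nats s1 ''best'' 0) (nats s1 ''red'' 0 - nats s1 ''blue'' 0)"
    show "runs (raise_best ''blue'' ''red'') s2 30 ?Q"
    proof (rule runs_mono[OF runs_raise_best])
      fix s3 assume s3: "agree {''best''} s2 s3 \<and>
        nats s3 ''best'' 0 = max (nats s2 ''best'' 0) (nats s2 ''blue'' 0 - nats s2 ''red'' 0)"
      have "agree {''red'', ''blue'', ''m'', ''best''} s s2"
        using s1(1) s2 by (auto intro: agree_trans)
      then have "agree {''red'', ''blue'', ''m'', ''best''} s s3"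
        using s3 by (auto intro: agree_trans)
      moreover have "nats s1 ''best'' = nats s ''best''" using s1 by (auto simp: agree_def)
      moreover have "nats s2 ''red'' = nats s1 ''red''" "nats s2 ''blue'' = nats s1 ''blue''"
        using s2 by (auto simp: agree_def)
      ultimately show "?Q s3"
        using s1 s2 s3 by (simp add: disc_def max_nat_diffs)
    qed auto
  qed auto
  then show ?thesis
    unfolding try_wedge_def
    by (intro runs_Seq[OF runs_mono[OF runs_count_wedge[OF s refl] order_refl]]) auto
qed

text \<open>Shared by the four nested loops. \<open>F i\<close> holds the values tried in round
  \<open>i\<close>, for all inner indices at once. Only two inequalities are carried:
  \<open>best\<close> dominates these values and stays below \<open>U\<close>.\<close>

lemma runs_search_level:
  assumes v: "v \<in> X" "v \<noteq> ''n''" "v \<noteq> ''best''" "v \<notin> Y" and X: "insert v Y \<subseteq> X" "X \<subseteq> scratch" "''best'' \<in> X"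
    and s: "ready s" "nats s ''best'' 0 \<le> U"
    and body: "\<And>i s'. i < length ps \<Longrightarrow> ready s' \<Longrightarrow> agree X s s' \<Longrightarrow> nats s' v 0 = i \<Longrightarrow>
       nats s' ''best'' 0 \<le> U \<Longrightarrow>
       runs c s' T (\<lambda>s''. agree Y s' s'' \<and> nats s' ''best'' 0 \<le> nats s'' ''best'' 0 \<and>
          nats s'' ''best'' 0 \<le> U \<and> (\<forall>d\<in>F i. d \<le> nats s'' ''best'' 0))"
  shows "runs (for_below_n v c) s (9 + length ps * (T + 12))
     (\<lambda>s'. agree X s s' \<and> nats s ''best'' 0 \<le> nats s' ''best'' 0 \<and> nats s' ''best'' 0 \<le> U \<and>
       (\<forall>i<length ps. \<forall>d\<in>F i. d \<le> nats s' ''best'' 0))"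
proof -
  let ?I = "\<lambda>i s'. agree X s s' \<and> nats s' v 0 = i \<and> nats s ''best'' 0 \<le> nats s' ''best'' 0 \<and>
     nats s' ''best'' 0 \<le> U \<and> (\<forall>i'<i. \<forall>d\<in>F i'. d \<le> nats s' ''best'' 0)"
  have "runs (for_below_n v c) s (9 + length ps * (T + 12)) (?I (length ps))"
  proof (rule runs_for_below_n[where T = T and I = ?I and n = "length ps"])
    show "?I 0 (nset v 0 0 s)" using v s by (auto intro!: agree_nset)
  next
    fix i s' assume "?I i s'"
    then show "nats s' v 0 = i \<and> nats s' ''n'' 0 = length ps"
      using ready_n ready_agree[OF s(1) _ X(2)] by blast
  next
    fix i s' assume i: "i < length ps" and I: "?I i s'"
    then have "ready s'" using ready_agree[OF s(1) _ X(2)] by blast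
    show "runs c s' T (\<lambda>s''. nats s'' v 0 = i \<and> ?I (Suc i) (nset v 0 (Suc i) s''))"
    proof (rule runs_mono[OF body[OF i \<open>ready s'\<close>] order_refl])
      fix s'' assume *: "agree Y s' s'' \<and> nats s' ''best'' 0 \<le> nats s'' ''best'' 0 \<and>
          nats s'' ''best'' 0 \<le> U \<and> (\<forall>d\<in>F i. d \<le> nats s'' ''best'' 0)"
      moreover from this have "agree X s s''"
        using I X by (auto intro: agree_trans)
      moreover have "nats s'' v = nats s' v"
        using * v by (auto simp: agree_def)
      ultimately show "nats s'' v 0 = i \<and> ?I (Suc i) (nset v 0 (Suc i) s'')"
        using I v by (auto intro!: agree_nset simp: less_Suc_eq intro: order_trans)
    qed (use I in auto)
  qed simp
  then show ?thesis by (rule runs_mono) auto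
qed

text \<open>\<open>T1\<close> to \<open>T4\<close> bound the loops from the innermost outwards; 212
  is 200 from \<open>runs_try_wedge\<close> plus the overhead 12 of a round.\<close>

lemma runs_best_wedge:
  assumes U: "1 \<le> U"
    "\<And>i j k l. i < length ps \<Longrightarrow> j < length ps \<Longrightarrow> k < length ps \<Longrightarrow> l < length ps \<Longrightarrow> wedge_disc i j k l \<le> U"
    and T: "T1 = 9 + length ps * (212 + length ps * 300)" "T2 = 9 + length ps * (T1 + 12)"
      "T3 = 9 + length ps * (T2 + 12)" "T4 = 9 + length ps * (T3 + 12)"
  shows "runs best_wedge (input ps R) (T4 + 20) (\<lambda>s. \<exists>b. output_value s = real b / 6 \<and> 1 \<le> b \<and> b \<le> U \<and>
     (\<forall>i<length ps. \<forall>j<length ps. \<forall>k<length ps. \<forall>l<length ps. wedge_disc i j k l \<le> b))"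
proof -
  let ?n = "length ps"
  let ?b = "\<lambda>s. nats s ''best'' 0"
  let ?Y = "{''red'', ''blue'', ''m'', ''best''}"
  have l: "runs (for_below_n ''l'' try_wedge) s T1
     (\<lambda>s'. agree (insert ''l'' ?Y) s s' \<and> ?b s \<le> ?b s' \<and> ?b s' \<le> U \<and>
       (\<forall>d\<in>{wedge_disc (nats s ''i'' 0) (nats s ''j'' 0) (nats s ''k'' 0) l |l. l < ?n}. d \<le> ?b s'))"
    if s: "ready s" "?b s \<le> U" "nats s ''i'' 0 < ?n" "nats s ''j'' 0 < ?n" "nats s ''k'' 0 < ?n" for s
  proof (rule runs_mono[OF runs_search_level[where X = "insert ''l'' ?Y" and Y = ?Y and T = "200 + ?n * 300" and U = U
       and F = "\<lambda>l. {wedge_disc (nats s ''i'' 0) (nats s ''j'' 0) (nats s ''k'' 0) l}"]])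
    fix l s' assume s': "l < ?n" "ready s'" "agree (insert ''l'' ?Y) s s'" "nats s' ''l'' 0 = l" "?b s' \<le> U"
    then have same: "nats s' ''i'' = nats s ''i''" "nats s' ''j'' = nats s ''j''" "nats s' ''k'' = nats s ''k''"
      by (auto simp: agree_def)
    show "runs try_wedge s' (200 + ?n * 300) (\<lambda>s''. agree ?Y s' s'' \<and> ?b s' \<le> ?b s'' \<and> ?b s'' \<le> U \<and>
       (\<forall>d\<in>{wedge_disc (nats s ''i'' 0) (nats s ''j'' 0) (nats s ''k'' 0) l}. d \<le> ?b s''))"
      by (rule runs_mono[OF runs_try_wedge]) (use s s' same U(2)[OF s(3-5) s'(1)] in auto)
  qed (use s T in auto)
  have k: "runs (for_below_n ''k'' (for_below_n ''l'' try_wedge)) s T2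
     (\<lambda>s'. agree (insert ''k'' (insert ''l'' ?Y)) s s' \<and> ?b s \<le> ?b s' \<and> ?b s' \<le> U \<and>
       (\<forall>d\<in>{wedge_disc (nats s ''i'' 0) (nats s ''j'' 0) k l |k l. k < ?n \<and> l < ?n}. d \<le> ?b s'))"
    if s: "ready s" "?b s \<le> U" "nats s ''i'' 0 < ?n" "nats s ''j'' 0 < ?n" for s
  proof (rule runs_mono[OF runs_search_level[where X = "insert ''k'' (insert ''l'' ?Y)"
       and Y = "insert ''l'' ?Y" and T = T1 and U = U
       and F = "\<lambda>k. {wedge_disc (nats s ''i'' 0) (nats s ''j'' 0) k l |l. l < ?n}"]])
    fix k s' assume s': "k < ?n" "ready s'" "agree (insert ''k'' (insert ''l'' ?Y)) s s'"
      "nats s' ''k'' 0 = k" "?b s' \<le> U"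
    then have "nats s' ''i'' = nats s ''i''" "nats s' ''j'' = nats s ''j''"
      by (auto simp: agree_def)
    then show "runs (for_below_n ''l'' try_wedge) s' T1
      (\<lambda>s''. agree (insert ''l'' ?Y) s' s'' \<and> ?b s' \<le> ?b s'' \<and> ?b s'' \<le> U \<and>
       (\<forall>d\<in>{wedge_disc (nats s ''i'' 0) (nats s ''j'' 0) k l |l. l < ?n}. d \<le> ?b s''))"
      using l[of s'] s s' by simp
  qed (use s T in auto)
  have j: "runs (for_below_n ''j'' (for_below_n ''k'' (for_below_n ''l'' try_wedge))) s T3
     (\<lambda>s'. agree (insert ''j'' (insert ''k'' (insert ''l'' ?Y))) s s' \<and> ?b s \<le> ?b s' \<and> ?b s' \<le> U \<and>
       (\<forall>d\<in>{wedge_disc (nats s ''i'' 0) j k l |j k l. j < ?n \<and> k < ?n \<and> l < ?n}. d \<le> ?b s'))"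
    if s: "ready s" "?b s \<le> U" "nats s ''i'' 0 < ?n" for s
  proof (rule runs_mono[OF runs_search_level[where X = "insert ''j'' (insert ''k'' (insert ''l'' ?Y))"
       and Y = "insert ''k'' (insert ''l'' ?Y)" and T = T2 and U = U
       and F = "\<lambda>j. {wedge_disc (nats s ''i'' 0) j k l |k l. k < ?n \<and> l < ?n}"]])
    fix j s' assume s': "j < ?n" "ready s'" "agree (insert ''j'' (insert ''k'' (insert ''l'' ?Y))) s s'"
      "nats s' ''j'' 0 = j" "?b s' \<le> U"
    then have "nats s' ''i'' = nats s ''i''"
      by (auto simp: agree_def)
    then show "runs (for_below_n ''k'' (for_below_n ''l'' try_wedge)) s' T2
      (\<lambda>s''. agree (insert ''k'' (insert ''l'' ?Y)) s' s'' \<and> ?b s' \<le> ?b s'' \<and> ?b s'' \<le> U \<and>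
       (\<forall>d\<in>{wedge_disc (nats s ''i'' 0) j k l |k l. k < ?n \<and> l < ?n}. d \<le> ?b s''))"
      using k[of s'] s s' by simp
  qed (use s T in auto)
  have i: "runs (for_below_n ''i'' (for_below_n ''j'' (for_below_n ''k'' (for_below_n ''l'' try_wedge)))) s T4
     (\<lambda>s'. agree (insert ''i'' (insert ''j'' (insert ''k'' (insert ''l'' ?Y)))) s s' \<and> ?b s \<le> ?b s' \<and> ?b s' \<le> U \<and>
       (\<forall>d\<in>{wedge_disc i j k l |i j k l. i < ?n \<and> j < ?n \<and> k < ?n \<and> l < ?n}. d \<le> ?b s'))"
    if s: "ready s" "?b s \<le> U" for s
  proof (rule runs_mono[OF runs_search_level[where X = "insert ''i'' (insert ''j'' (insert ''k'' (insert ''l'' ?Y)))"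
       and Y = "insert ''j'' (insert ''k'' (insert ''l'' ?Y))" and T = T3 and U = U
       and F = "\<lambda>i. {wedge_disc i j k l |j k l. j < ?n \<and> k < ?n \<and> l < ?n}"]])
    fix i s' assume s': "i < ?n" "ready s'" "nats s' ''i'' 0 = i" "?b s' \<le> U"
    then show "runs (for_below_n ''j'' (for_below_n ''k'' (for_below_n ''l'' try_wedge))) s' T3
      (\<lambda>s''. agree (insert ''j'' (insert ''k'' (insert ''l'' ?Y))) s' s'' \<and> ?b s' \<le> ?b s'' \<and> ?b s'' \<le> U \<and>
       (\<forall>d\<in>{wedge_disc i j k l |j k l. j < ?n \<and> k < ?n \<and> l < ?n}. d \<le> ?b s''))"
      using j[of s'] by simp
  qed (use s T in \<open>auto, blast\<close>)
  have start: "ready (nset ''best'' 0 1 (input ps R))"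
    by (intro ready_nset) (auto simp: ready_def)
  show ?thesis
    unfolding best_wedge_def
  proof (rule runs_Seq[where T = 3 and U = "T4 + 17", OF runs_NSet])
    show "runs (Seq (for_below_n ''i'' (for_below_n ''j'' (for_below_n ''k'' (for_below_n ''l'' try_wedge))))
          (RSet ''out'' (NConst 0) (RDiv (RNat (nvar ''best'')) (RNat (NConst 6)))))
        (nset ''best'' (nval (NConst 0) (input ps R)) (nval (NConst 1) (input ps R)) (input ps R)) (T4 + 17)
        (\<lambda>s. \<exists>b. output_value s = real b / 6 \<and> 1 \<le> b \<and> b \<le> U \<and>
          (\<forall>i<?n. \<forall>j<?n. \<forall>k<?n. \<forall>l<?n. wedge_disc i j k l \<le> b))"
    proof (rule runs_Seq[where T = T4 and U = 15, OF runs_mono[OF i order_refl runs_RSet]])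
      fix s assume "agree (insert ''i'' (insert ''j'' (insert ''k'' (insert ''l'' ?Y))))
          (nset ''best'' (nval (NConst 0) (input ps R)) (nval (NConst 1) (input ps R)) (input ps R)) s \<and>
          ?b (nset ''best'' (nval (NConst 0) (input ps R)) (nval (NConst 1) (input ps R)) (input ps R)) \<le> ?b s \<and>
          ?b s \<le> U \<and> (\<forall>d\<in>{wedge_disc i j k l |i j k l. i < ?n \<and> j < ?n \<and> k < ?n \<and> l < ?n}. d \<le> ?b s)"
      then show "\<exists>b. output_value (rset ''out'' (nval (NConst 0) s)
           (rval (RDiv (RNat (nvar ''best'')) (RNat (NConst 6))) s) s) = real b / 6 \<and> 1 \<le> b \<and> b \<le> U \<and>
          (\<forall>i<?n. \<forall>j<?n. \<forall>k<?n. \<forall>l<?n. wedge_disc i j k l \<le> b)"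
        by (intro exI[of _ "?b s"]) (auto simp: output_value_def rset_def, blast)
    qed (use start U in auto)
  qed auto
qed

end

section \<open>The time polynomial and the approximation factor\<close>

text \<open>The recurrence of \<open>runs_best_wedge\<close> written with polynomials: four loops
  around a linear body, so the degree is 5.\<close>

definition time_bound :: "nat poly" where
  "time_bound =
     (let loop = (\<lambda>q. [:9:] + [:0, 1:] * (q + [:12:])) in loop (loop (loop (loop [:200, 300:]))) + [:20:])"

theorem theorem15:
  "\<exists>(c::real) (algorithm::com) (p::nat poly). 0 < c \<and> c \<le> 1 \<and>
     (\<forall>(R::(real^2) set) (B::(real^2) set) (ps::(real^2) list).
        R \<inter> B = {} \<and> R \<union> B \<noteq> {} \<and> general_position (R \<union> B) \<and>
        distinct ps \<and> set ps = R \<union> B \<longrightarrow>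
        (\<exists>t s. exec algorithm (input ps R) t s \<and>
           t \<le> poly p (length ps) \<and>
           c * real_of_int (coarseness R B) \<le> output_value s \<and>
           output_value s \<le> real_of_int (coarseness R B)))"
\<comment> \<open>Here 24 is 4 from \<open>coarse_le_wedges\<close> times the 6 by which the output
  is divided.\<close>
proof (intro exI[of _ "1 / (24 * 3 ^ 8) :: real"] exI[of _ best_wedge] exI[of _ time_bound] conjI allI impI)
  show "0 < (1 / (24 * 3 ^ 8) :: real)" "(1 / (24 * 3 ^ 8) :: real) \<le> 1" by simp_all
  fix R B :: "(real^2) set" and ps :: "(real^2) list"
  assume asm: "R \<inter> B = {} \<and> R \<union> B \<noteq> {} \<and> general_position (R \<union> B) \<and> distinct ps \<and> set ps = R \<union> B"
  then have fin: "finite R" "finite B" by (metis List.finite_set finite_Un)+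
  interpret bicolored R B
    using asm fin by unfold_locales auto
  let ?disc = "\<lambda>i j k l. nat (disc R B (wedge (ps ! i) (ps ! j) (ps ! k) (ps ! l)))"
  have U: "1 \<le> nat (6 * coarse)" "?disc i j k l \<le> nat (6 * coarse)" for i j k l
    using one_le_coarse disc_wedge_le by (auto intro!: nat_mono)
  have "runs best_wedge (input ps R) (poly time_bound (length ps)) (\<lambda>s. \<exists>b. output_value s = real b / 6 \<and> 1 \<le> b \<and>
     b \<le> nat (6 * coarse) \<and>
     (\<forall>i<length ps. \<forall>j<length ps. \<forall>k<length ps. \<forall>l<length ps. ?disc i j k l \<le> b))"
    by (rule runs_mono[OF runs_best_wedge[OF _ _ _ U(1) U(2) refl refl refl refl]])
      (use asm in \<open>auto simp: time_bound_def Let_def algebra_simps\<close>)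
  then obtain t s b where run: "exec best_wedge (input ps R) t s" "t \<le> poly time_bound (length ps)"
    and out: "output_value s = real b / 6" and b: "1 \<le> b" "b \<le> nat (6 * coarse)"
    "\<And>i j k l. i < length ps \<Longrightarrow> j < length ps \<Longrightarrow> k < length ps \<Longrightarrow> l < length ps \<Longrightarrow> ?disc i j k l \<le> b"
    unfolding runs_def by blast
  have "coarse \<le> 3 ^ 8 * (4 * int b)"
  proof (rule coarse_le_wedges)
    fix p q r s assume "p \<in> S" "q \<in> S" "r \<in> S" "s \<in> S"
    then have "p \<in> set ps" "q \<in> set ps" "r \<in> set ps" "s \<in> set ps" using asm by simp_all
    then obtain i j k l where "i < length ps" "j < length ps" "k < length ps" "l < length ps"
      "p = ps ! i" "q = ps ! j" "r = ps ! k" "s = ps ! l"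
      unfolding in_set_conv_nth by blast
    then show "disc R B (wedge p q r s) \<le> int b" using b(3)[of i j k l] by simp
  qed (use b in simp)
  then have "real_of_int coarse \<le> real_of_int (3 ^ 8 * (4 * int b))"
    by (simp only: of_int_le_iff)
  then have lower: "real_of_int coarse \<le> 3 ^ 8 * (4 * real b)" by simp
  have "int b \<le> 6 * coarse" using b(1,2) by linarith
  then have upper: "real b \<le> 6 * real_of_int coarse" by linarith
  show "\<exists>t s. exec best_wedge (input ps R) t s \<and> t \<le> poly time_bound (length ps) \<and>
      1 / (24 * 3 ^ 8) * real_of_int coarse \<le> output_value s \<and> output_value s \<le> real_of_int coarse"
    using run lower upper by (intro exI[of _ t] exI[of _ s] conjI) (simp_all add: out)
qed

end
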